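(* Let $p\ge3$ be a prime, let $\lambda=\{\lambda_n\}_{n\ge1}\in c_0$ be a sequence in $\mathbb Q_p$ tending to $0$, put $\theta=\sum_{n=1}^\infty\lambda_n$, assume $\theta\ne0$ and $\theta\neq4$, and let $F:\{x_n\}\mapsto\{y_n\}$ be the operator on $c_0$ given by $y_n=\lambda_n\left(\frac{1}{1+\sum_{m=1}^{\infty}x_m}\right)^2$. Write $\theta=p^{\mathrm{ord}_p\theta}(\theta_0+\theta_1p+\theta_2p^2+\cdots)$ with digits $\theta_j\in\{0,\dots,p-1\}$, $\theta_0\neq0$. Then the following statements hold for the number $|\mathrm{Per}_2\{F\}|$ of $2$-periodic points of $F$. It equals: - $2$, if $|\theta|_p>1$; - $2$, if $|\theta|_p<1$, $2\mid\mathrm{ord}_p\theta$ and $\left(\frac{-\theta_0}{p}\right)=1$; - $0$, if $|\theta|_p<1$ and ($2\nmid\mathrm{ord}_p\theta$ or $\left(\frac{-\theta_0}{p}\right)=-1$); - $2$, if $|\theta|_p=1$ and $\left(\frac{\theta_0^2-4\theta_0}{p}\right)=1$; - $0$, if $|\theta|_p=1$ and $\left(\frac{\theta_0^2-4\theta_0}{p}\right)=-1$; - $2$, if $|\theta|_p=1$, $2\mid\mathrm{ord}_p(\theta-4)$ and $\left(\frac{|\theta-4|_p(\theta-4)\bmod p}{p}\right)=1$; - $0$, if $|\theta|_p=1$ and ($2\nmid\mathrm{ord}_p(\theta-4)$ or $\left(\frac{|\theta-4|_p(\theta-4)\bmod p}{p}\right)=-1$).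
   Context: $\mathbb Q_p$ is the field of $p$-adic numbers with norm $|x|_p=p^{-\mathrm{ord}_px}$. $c_0$ is the space of sequences $\{x_n\}_{n\ge1}\subset\mathbb Q_p$ with $\lim x_n=0$. $F$ is applied only to $x\in c_0$ with $\sum_nx_n\ne-1$. $\mathrm{Fix}\{F\}=\{x\in c_0: Fx=x\}$ and $\mathrm{Per}_2\{F\}=\{x\in c_0: F(Fx)=x\}\setminus\mathrm{Fix}\{F\}$ (all expressions being required to be defined). $\left(\frac{a}{p}\right)$ is the Legendre symbol, defined for integers $a$ not divisible by $p$: it is $1$ if $a$ is a quadratic residue modulo $p$ and $-1$ otherwise. $|\theta-4|_p(\theta-4)$ denotes the $p$-adic unit $p^{-\mathrm{ord}_p(\theta-4)}(\theta-4)$, reduced modulo $p$.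
   Formalization: The last two items (conditions on θ−4) are stated only when p divides θ₀²−4θ₀, i.e. θ₀≡4 mod p; read literally they contradict the two preceding items (e.g. p=7, θ=5: one item gives 0, another gives 2). *)

theory Defs
  imports Complex_Main "HOL-Number_Theory.Residues" "Berlekamp_Zassenhaus.Finite_Field"
begin

section \<open>The $p$-adic absolute value on the rationals\<close>

definition rat_ord :: "nat \<Rightarrow> rat \<Rightarrow> int" where
  "rat_ord p x = (case quotient_of x of (a, b) \<Rightarrow>
     int (multiplicity (int p) a) - int (multiplicity (int p) b))"

definition rat_pabs :: "nat \<Rightarrow> rat \<Rightarrow> real" where
  "rat_pabs p x = (if x = 0 then 0 else real p powi (- rat_ord p x))"

lemma rat_ord_Fract:
  assumes p: "prime p" and a: "a \<noteq> 0" and b: "b \<noteq> 0"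
  shows "rat_ord p (Rat.Fract a b) = int (multiplicity (int p) a) - int (multiplicity (int p) b)"
proof -
  obtain c d where q: "quotient_of (Rat.Fract a b) = (c, d)" by fastforce
  have d: "d > 0" by (rule quotient_of_denom_pos[OF q])
  have eq: "Rat.Fract a b = Rat.Fract c d"
    using quotient_of_div[OF q] by (simp add: Fract_of_int_quotient)
  hence cb: "a * d = c * b" using b d by (simp add: eq_rat)
  hence c: "c \<noteq> 0" using a d by auto
  have P: "prime_elem (int p)" using p by simp
  have "multiplicity (int p) a + multiplicity (int p) d =
        multiplicity (int p) c + multiplicity (int p) b"
    using arg_cong[OF cb, of "multiplicity (int p)"] P a b c d
    by (simp add: prime_elem_multiplicity_mult_distrib)
  thus ?thesis unfolding rat_ord_def q by simp
qed

lemma rat_pabs_0 [simp]: "rat_pabs p 0 = 0"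
  by (simp add: rat_pabs_def)

lemma rat_pabs_1 [simp]: "rat_pabs p 1 = 1"
  by (simp add: rat_pabs_def rat_ord_def)

lemma rat_pabs_nonneg [simp]: "rat_pabs p x \<ge> 0"
  by (simp add: rat_pabs_def)

lemma rat_pabs_eq_0_iff [simp]: "prime p \<Longrightarrow> rat_pabs p x = 0 \<longleftrightarrow> x = 0"
  by (auto simp: rat_pabs_def)

lemma rat_pabs_mult:
  assumes p: "prime p"
  shows "rat_pabs p (x * y) = rat_pabs p x * rat_pabs p y"
proof (cases "x = 0 \<or> y = 0")
  case False
  obtain a b where x: "x = Rat.Fract a b" "b > 0" by (cases x) auto
  obtain c d where y: "y = Rat.Fract c d" "d > 0" by (cases y) auto
  have nz: "a \<noteq> 0" "c \<noteq> 0" using False x y by (auto simp: rat_number_collapse)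
  have P: "prime_elem (int p)" using p by simp
  have "rat_ord p (x * y) = rat_ord p x + rat_ord p y"
    using x y nz P p by (simp add: rat_ord_Fract prime_elem_multiplicity_mult_distrib)
  moreover have "real p \<noteq> 0" using p by (auto simp: prime_gt_0_nat)
  ultimately show ?thesis using False
    by (simp add: rat_pabs_def power_int_diff power_int_minus divide_inverse)
qed (auto simp: rat_pabs_def)

lemma rat_pabs_minus [simp]:
  assumes p: "prime p" shows "rat_pabs p (- x) = rat_pabs p x"
proof -
  have "rat_pabs p (-1) * rat_pabs p (-1) = 1"
    using rat_pabs_mult[OF p, of "-1" "-1"] by simp
  hence "rat_pabs p (-1) = 1"
    using rat_pabs_nonneg[of p "-1"] by (simp add: square_eq_1_iff)
  thus ?thesis using rat_pabs_mult[OF p, of "-1" x] by simp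
qed

lemma rat_pabs_diff_commute: "prime p \<Longrightarrow> rat_pabs p (x - y) = rat_pabs p (y - x)"
  using rat_pabs_minus[of p "x - y"] by simp

lemma rat_pabs_inverse:
  assumes p: "prime p" shows "rat_pabs p (inverse x) = inverse (rat_pabs p x)"
proof (cases "x = 0")
  case False
  thus ?thesis using rat_pabs_mult[OF p, of "inverse x" x] p
    by (simp add: field_simps)
qed simp

lemma rat_pabs_add_le_max:
  assumes p: "prime p"
  shows "rat_pabs p (x + y) \<le> max (rat_pabs p x) (rat_pabs p y)"
proof (cases "x = 0 \<or> y = 0 \<or> x + y = 0")
  case False
  obtain a b where x: "x = Rat.Fract a b" "b > 0" by (cases x) auto
  obtain c d where y: "y = Rat.Fract c d" "d > 0" by (cases y) auto
  have nz: "a \<noteq> 0" "c \<noteq> 0" using False x y by (auto simp: rat_number_collapse)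
  have xy: "x + y = Rat.Fract (a * d + c * b) (b * d)" using x y by simp
  have s: "a * d + c * b \<noteq> 0"
    using False unfolding xy by (metis rat_number_collapse(1))
  have P: "prime_elem (int p)" using p by simp
  let ?m = "multiplicity (int p)"
  define k where "k = min (?m (a * d)) (?m (c * b))"
  have "int p ^ k dvd a * d" "int p ^ k dvd c * b"
    by (rule multiplicity_dvd', simp add: k_def)+
  hence "int p ^ k dvd a * d + c * b" by simp
  hence "k \<le> ?m (a * d + c * b)"
    using s p by (intro multiplicity_geI) (auto simp: prime_nat_iff)
  hence "rat_ord p (x + y) \<ge> int k - int (?m b) - int (?m d)"
    using x y s P p unfolding xy
    by (simp add: rat_ord_Fract prime_elem_multiplicity_mult_distrib)
  moreover have "int k - int (?m b) - int (?m d) = min (rat_ord p x) (rat_ord p y)"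
    using x y nz P p
    by (simp add: k_def rat_ord_Fract prime_elem_multiplicity_mult_distrib min_def)
  ultimately have "- rat_ord p (x + y) \<le> - rat_ord p x \<or> - rat_ord p (x + y) \<le> - rat_ord p y"
    by linarith
  moreover have "real p \<ge> 1" using prime_ge_1_nat[OF p] by simp
  ultimately show ?thesis using False
    by (auto simp: rat_pabs_def le_max_iff_disj simp del: power_int_minus
             intro: power_int_increasing)
qed (use p in \<open>auto simp: add_eq_0_iff\<close>)

lemma rat_pabs_triangle: "prime p \<Longrightarrow> rat_pabs p (x + y) \<le> rat_pabs p x + rat_pabs p y"
  using rat_pabs_add_le_max[of p x y] rat_pabs_nonneg[of p x] rat_pabs_nonneg[of p y] by linarith

lemma rat_pabs_reverse_triangle:
  assumes p: "prime p" shows "\<bar>rat_pabs p x - rat_pabs p y\<bar> \<le> rat_pabs p (x - y)"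
  using rat_pabs_triangle[OF p, of "x - y" y] rat_pabs_triangle[OF p, of "y - x" x]
    rat_pabs_diff_commute[OF p, of x y] by simp


section \<open>Cauchy sequences and null sequences\<close>

definition pcauchy :: "nat \<Rightarrow> (nat \<Rightarrow> rat) \<Rightarrow> bool" where
  "pcauchy p X \<longleftrightarrow> (\<forall>e>0. \<exists>k. \<forall>m\<ge>k. \<forall>n\<ge>k. rat_pabs p (X m - X n) < e)"

definition pnull :: "nat \<Rightarrow> (nat \<Rightarrow> rat) \<Rightarrow> bool" where
  "pnull p X \<longleftrightarrow> (\<lambda>n. rat_pabs p (X n)) \<longlonglongrightarrow> 0"

lemma pnull_0 [simp]: "pnull p (\<lambda>n. 0)"
  by (simp add: pnull_def)

lemma pnull_const [simp]: "prime p \<Longrightarrow> pnull p (\<lambda>n. c) \<longleftrightarrow> c = 0"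
  by (simp add: pnull_def LIMSEQ_const_iff)

lemma pnull_le:
  assumes "pnull p Y" "eventually (\<lambda>n. rat_pabs p (X n) \<le> C * rat_pabs p (Y n)) sequentially"
  shows "pnull p X"
  unfolding pnull_def
proof (rule tendsto_sandwich[where f = "\<lambda>_. 0", OF _ assms(2)])
  show "(\<lambda>n. C * rat_pabs p (Y n)) \<longlonglongrightarrow> 0"
    using assms(1) unfolding pnull_def by (rule tendsto_mult_right_zero)
qed auto

lemma pnull_add:
  assumes p: "prime p" and X: "pnull p X" and Y: "pnull p Y"
  shows "pnull p (\<lambda>n. X n + Y n)"
  unfolding pnull_def
proof (rule tendsto_sandwich[where f = "\<lambda>_. 0"])
  show "(\<lambda>n. rat_pabs p (X n) + rat_pabs p (Y n)) \<longlonglongrightarrow> 0"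
    using tendsto_add[OF X[unfolded pnull_def] Y[unfolded pnull_def]] by simp
qed (auto intro!: always_eventually rat_pabs_triangle p)

lemma pnull_minus: "prime p \<Longrightarrow> pnull p X \<Longrightarrow> pnull p (\<lambda>n. - X n)"
  by (simp add: pnull_def)

lemma pnull_diff:
  "prime p \<Longrightarrow> pnull p X \<Longrightarrow> pnull p Y \<Longrightarrow> pnull p (\<lambda>n. X n - Y n)"
  using pnull_add[of p X "\<lambda>n. - Y n"] pnull_minus[of p Y] by simp

lemma pcauchy_const [simp]: "pcauchy p (\<lambda>n. c)"
  by (simp add: pcauchy_def)

lemma pcauchyD:
  "pcauchy p X \<Longrightarrow> e > 0 \<Longrightarrow> \<exists>k. \<forall>m\<ge>k. \<forall>n\<ge>k. rat_pabs p (X m - X n) < e"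
  by (simp add: pcauchy_def)

lemma pcauchy_add:
  assumes p: "prime p" and X: "pcauchy p X" and Y: "pcauchy p Y"
  shows "pcauchy p (\<lambda>n. X n + Y n)"
  unfolding pcauchy_def
proof (intro allI impI)
  fix e :: real assume e: "e > 0"
  obtain k where k: "\<And>m n. m \<ge> k \<Longrightarrow> n \<ge> k \<Longrightarrow> rat_pabs p (X m - X n) < e"
    using pcauchyD[OF X e] by auto
  obtain l where l: "\<And>m n. m \<ge> l \<Longrightarrow> n \<ge> l \<Longrightarrow> rat_pabs p (Y m - Y n) < e"
    using pcauchyD[OF Y e] by auto
  have "rat_pabs p ((X m + Y m) - (X n + Y n)) < e" if "m \<ge> max k l" "n \<ge> max k l" for m n
    using rat_pabs_add_le_max[OF p, of "X m - X n" "Y m - Y n"] k[of m n] l[of m n] that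
    by (simp add: add_diff_add)
  thus "\<exists>k. \<forall>m\<ge>k. \<forall>n\<ge>k. rat_pabs p ((X m + Y m) - (X n + Y n)) < e" by blast
qed

lemma pcauchy_minus: "prime p \<Longrightarrow> pcauchy p X \<Longrightarrow> pcauchy p (\<lambda>n. - X n)"
  using rat_pabs_diff_commute[of p] by (simp add: pcauchy_def)

lemma pcauchy_Cauchy_rat_pabs:
  assumes p: "prime p" and X: "pcauchy p X"
  shows "Cauchy (\<lambda>n. rat_pabs p (X n))"
proof (rule metric_CauchyI)
  fix e :: real assume e: "e > 0"
  obtain k where k: "\<And>m n. m \<ge> k \<Longrightarrow> n \<ge> k \<Longrightarrow> rat_pabs p (X m - X n) < e"
    using pcauchyD[OF X e] by auto
  show "\<exists>M. \<forall>m\<ge>M. \<forall>n\<ge>M. dist (rat_pabs p (X m)) (rat_pabs p (X n)) < e"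
    using k rat_pabs_reverse_triangle[OF p] unfolding dist_real_def
    by (meson le_less_trans)
qed

lemma pcauchy_convergent:
  "prime p \<Longrightarrow> pcauchy p X \<Longrightarrow> (\<lambda>n. rat_pabs p (X n)) \<longlonglongrightarrow> lim (\<lambda>n. rat_pabs p (X n))"
  using pcauchy_Cauchy_rat_pabs Cauchy_convergent convergent_LIMSEQ_iff by blast

lemma pcauchy_bounded:
  assumes p: "prime p" and X: "pcauchy p X"
  obtains B where "B > 0" "\<And>n. rat_pabs p (X n) \<le> B"
proof -
  have "Bseq (\<lambda>n. rat_pabs p (X n))"
    by (rule Cauchy_Bseq[OF pcauchy_Cauchy_rat_pabs[OF p X]])
  thus ?thesis using that unfolding Bseq_def by auto
qed

lemma pcauchy_mult:
  assumes p: "prime p" and X: "pcauchy p X" and Y: "pcauchy p Y"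
  shows "pcauchy p (\<lambda>n. X n * Y n)"
  unfolding pcauchy_def
proof (intro allI impI)
  fix e :: real assume e: "e > 0"
  obtain A where A: "A > 0" "\<And>n. rat_pabs p (X n) \<le> A" by (rule pcauchy_bounded[OF p X]) auto
  obtain B where B: "B > 0" "\<And>n. rat_pabs p (Y n) \<le> B" by (rule pcauchy_bounded[OF p Y]) auto
  have eA: "e / A > 0" and eB: "e / B > 0" using e A B by auto
  obtain k where k: "\<And>m n. m \<ge> k \<Longrightarrow> n \<ge> k \<Longrightarrow> rat_pabs p (X m - X n) < e / B"
    using pcauchyD[OF X eB] by auto
  obtain l where l: "\<And>m n. m \<ge> l \<Longrightarrow> n \<ge> l \<Longrightarrow> rat_pabs p (Y m - Y n) < e / A"
    using pcauchyD[OF Y eA] by auto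
  have "rat_pabs p (X m * Y m - X n * Y n) < e" if "m \<ge> max k l" "n \<ge> max k l" for m n
  proof -
    have 1: "rat_pabs p (X m) * rat_pabs p (Y m - Y n) \<le> A * rat_pabs p (Y m - Y n)"
      using A by (intro mult_right_mono) auto
    have 2: "rat_pabs p (X m - X n) * rat_pabs p (Y n) \<le> rat_pabs p (X m - X n) * B"
      using B by (intro mult_left_mono) auto
    have 3: "A * rat_pabs p (Y m - Y n) < e"
      using l[of m n] that A by (simp add: field_simps)
    have 4: "rat_pabs p (X m - X n) * B < e"
      using k[of m n] that B by (simp add: field_simps)
    have "X m * Y m - X n * Y n = X m * (Y m - Y n) + (X m - X n) * Y n"
      by (simp add: algebra_simps)
    thus ?thesis using 1 2 3 4
        rat_pabs_add_le_max[OF p, of "X m * (Y m - Y n)" "(X m - X n) * Y n"]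
      by (simp add: rat_pabs_mult[OF p])
  qed
  thus "\<exists>k. \<forall>m\<ge>k. \<forall>n\<ge>k. rat_pabs p (X m * Y m - X n * Y n) < e" by blast
qed

lemma pnull_mult_bounded:
  assumes p: "prime p" and X: "pcauchy p X" and Y: "pnull p Y"
  shows "pnull p (\<lambda>n. X n * Y n)"
proof -
  obtain A where "A > 0" "\<And>n. rat_pabs p (X n) \<le> A" by (rule pcauchy_bounded[OF p X]) auto
  thus ?thesis
    by (intro pnull_le[OF Y, of _ A] always_eventually)
       (auto simp: rat_pabs_mult[OF p] intro: mult_right_mono)
qed

lemma pcauchy_not_pnull:
  assumes p: "prime p" and X: "pcauchy p X" and nz: "\<not> pnull p X"
  obtains b k where "b > 0" "\<And>n. n \<ge> k \<Longrightarrow> rat_pabs p (X n) > b"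
proof -
  let ?L = "lim (\<lambda>n. rat_pabs p (X n))"
  have L: "(\<lambda>n. rat_pabs p (X n)) \<longlonglongrightarrow> ?L" by (rule pcauchy_convergent[OF p X])
  have "?L \<ge> 0" by (rule LIMSEQ_le_const[OF L]) auto
  moreover have "?L \<noteq> 0" using L nz by (auto simp: pnull_def)
  ultimately have "?L > 0" by simp
  hence "eventually (\<lambda>n. rat_pabs p (X n) > ?L / 2) sequentially"
    using order_tendstoD(1)[OF L, of "?L / 2"] by simp
  thus ?thesis using that[of "?L / 2"] \<open>?L > 0\<close> unfolding eventually_sequentially by auto
qed

lemma rat_pabs_diff_inverse_le:
  assumes p: "prime p" and "a > 0" "b > 0" "rat_pabs p x > a" "rat_pabs p y > b"
  shows "rat_pabs p (inverse x - inverse y) \<le> inverse a * inverse b * rat_pabs p (x - y)"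
proof -
  have nz: "x \<noteq> 0" "y \<noteq> 0" using assms by auto
  hence "rat_pabs p (inverse x - inverse y) =
         inverse (rat_pabs p x) * inverse (rat_pabs p y) * rat_pabs p (x - y)"
    using rat_pabs_diff_commute[OF p, of x y]
    by (simp add: inverse_diff_inverse rat_pabs_mult[OF p] rat_pabs_inverse[OF p] p)
  also have "\<dots> \<le> inverse a * inverse b * rat_pabs p (x - y)"
    using assms by (intro mult_right_mono mult_mono) (auto intro: le_imp_inverse_le)
  finally show ?thesis .
qed

lemma pcauchy_inverse:
  assumes p: "prime p" and X: "pcauchy p X" and nz: "\<not> pnull p X"
  shows "pcauchy p (\<lambda>n. inverse (X n))"
  unfolding pcauchy_def
proof (intro allI impI)
  fix e :: real assume e: "e > 0"
  obtain b k where b: "b > 0" and k: "\<And>n. n \<ge> k \<Longrightarrow> rat_pabs p (X n) > b"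
    by (rule pcauchy_not_pnull[OF p X nz]) auto
  have "e * b * b > 0" using e b by simp
  then obtain l where l: "\<And>m n. m \<ge> l \<Longrightarrow> n \<ge> l \<Longrightarrow> rat_pabs p (X m - X n) < e * b * b"
    using pcauchyD[OF X] by blast
  have "rat_pabs p (inverse (X m) - inverse (X n)) < e" if "m \<ge> max k l" "n \<ge> max k l" for m n
  proof -
    have "rat_pabs p (inverse (X m) - inverse (X n)) \<le>
          inverse b * inverse b * rat_pabs p (X m - X n)"
      using that by (intro rat_pabs_diff_inverse_le p b k) auto
    also have "\<dots> < inverse b * inverse b * (e * b * b)"
      using that b by (intro mult_strict_left_mono l) auto
    also have "\<dots> = e" using b by (simp add: field_simps)
    finally show ?thesis .
  qed
  thus "\<exists>k. \<forall>m\<ge>k. \<forall>n\<ge>k. rat_pabs p (inverse (X m) - inverse (X n)) < e" by blast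
qed

lemma pnull_diff_inverse:
  assumes p: "prime p" and X: "pcauchy p X" "\<not> pnull p X" and Y: "pcauchy p Y" "\<not> pnull p Y"
    and XY: "pnull p (\<lambda>n. X n - Y n)"
  shows "pnull p (\<lambda>n. inverse (X n) - inverse (Y n))"
proof -
  obtain a k where a: "a > 0" and k: "\<And>n. n \<ge> k \<Longrightarrow> rat_pabs p (X n) > a"
    by (rule pcauchy_not_pnull[OF p X]) auto
  obtain b l where b: "b > 0" and l: "\<And>n. n \<ge> l \<Longrightarrow> rat_pabs p (Y n) > b"
    by (rule pcauchy_not_pnull[OF p Y]) auto
  show ?thesis
    by (rule pnull_le[OF XY, of _ "inverse a * inverse b"])
       (use eventually_ge_at_top[of "max k l"] in
         \<open>eventually_elim, auto intro!: rat_pabs_diff_inverse_le p a b k l\<close>)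
qed


section \<open>The field of $p$-adic numbers\<close>

text \<open>
  The type \<open>'a padic\<close> is the completion of the rationals with respect to the
  \<open>p\<close>-adic absolute value for the prime \<open>p = CARD('a)\<close>.
  It is set up by hand because \<open>quotient_type\<close> fails for a partial relation depending on a
  phantom type parameter.
\<close>

definition padicrel :: "nat \<Rightarrow> (nat \<Rightarrow> rat) \<Rightarrow> (nat \<Rightarrow> rat) \<Rightarrow> bool" where
  "padicrel p X Y \<longleftrightarrow> pcauchy p X \<and> pcauchy p Y \<and> pnull p (\<lambda>n. X n - Y n)"

lemma padicrel_refl: "pcauchy p X \<Longrightarrow> padicrel p X X"
  by (simp add: padicrel_def)

lemma part_equivp_padicrel:
  assumes p: "prime p" shows "part_equivp (padicrel p)"
proof (rule part_equivpI)
  show "\<exists>X. padicrel p X X" using padicrel_refl pcauchy_const by blast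
  show "symp (padicrel p)"
    using rat_pabs_diff_commute[OF p] by (simp add: symp_def padicrel_def pnull_def)
  show "transp (padicrel p)"
    by (rule transpI) (auto simp: padicrel_def dest: pnull_add[OF p])
qed

typedef (overloaded) 'a padic =
  "{C. \<exists>X. padicrel CARD('a :: prime_card) X X \<and> C = Collect (padicrel CARD('a) X)}"
  using padicrel_refl[OF pcauchy_const] by blast

definition abs_padic :: "(nat \<Rightarrow> rat) \<Rightarrow> 'a::prime_card padic" where
  "abs_padic X = Abs_padic (Collect (padicrel CARD('a) X))"

definition rep_padic :: "'a::prime_card padic \<Rightarrow> (nat \<Rightarrow> rat)" where
  "rep_padic x = (SOME X. X \<in> Rep_padic x)"

definition cr_padic :: "(nat \<Rightarrow> rat) \<Rightarrow> 'a::prime_card padic \<Rightarrow> bool" where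
  "cr_padic X x \<longleftrightarrow> padicrel CARD('a) X X \<and> abs_padic X = x"

lemma Quotient_padic:
  "Quotient (padicrel CARD('a)) (abs_padic :: _ \<Rightarrow> 'a::prime_card padic) rep_padic cr_padic"
proof (rule QuotientI)
  interpret quot_type "padicrel CARD('a)" "Abs_padic :: _ \<Rightarrow> 'a padic" Rep_padic
    using Rep_padic Rep_padic_inverse Abs_padic_inverse Rep_padic_inject
    by (intro quot_type.intro part_equivp_padicrel prime_card) blast+
  have eqs: "(abs_padic :: _ \<Rightarrow> 'a padic) = abs" "(rep_padic :: 'a padic \<Rightarrow> _) = rep"
    by (simp_all add: fun_eq_iff abs_padic_def rep_padic_def abs_def rep_def)
  note Q = Quotient[folded eqs]
  show "abs_padic (rep_padic x) = x" for x :: "'a padic"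
    by (rule Quotient3_abs_rep[OF Q])
  show "padicrel CARD('a) (rep_padic x) (rep_padic x)" for x :: "'a padic"
    by (rule Quotient3_rep_reflp[OF Q])
  show "padicrel CARD('a) X Y \<longleftrightarrow> padicrel CARD('a) X X \<and> padicrel CARD('a) Y Y \<and>
          (abs_padic X :: 'a padic) = abs_padic Y" for X Y
    using Quotient3_rel[OF Q, of X Y] by blast
  show "(cr_padic :: _ \<Rightarrow> 'a padic \<Rightarrow> _) = (\<lambda>X x. padicrel CARD('a) X X \<and> abs_padic X = x)"
    by (simp add: fun_eq_iff cr_padic_def)
qed

setup_lifting Quotient_padic

instantiation padic :: (prime_card) field
begin

lift_definition zero_padic :: "'a padic" is "\<lambda>n. 0"
  by (simp add: padicrel_refl)

lift_definition one_padic :: "'a padic" is "\<lambda>n. 1"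
  by (simp add: padicrel_refl)

lift_definition plus_padic :: "'a padic \<Rightarrow> 'a padic \<Rightarrow> 'a padic" is "\<lambda>X Y n. X n + Y n"
  by (simp add: padicrel_def add_diff_add pcauchy_add pnull_add prime_card)

lift_definition uminus_padic :: "'a padic \<Rightarrow> 'a padic" is "\<lambda>X n. - X n"
  unfolding padicrel_def minus_diff_minus
  by (simp only: pcauchy_minus pnull_minus prime_card simp_thms)

lift_definition minus_padic :: "'a padic \<Rightarrow> 'a padic \<Rightarrow> 'a padic" is "\<lambda>X Y n. X n - Y n"
proof -
  fix X X' Y Y' :: "nat \<Rightarrow> rat"
  have p: "prime CARD('a)" by (rule prime_card)
  assume "padicrel CARD('a) X X'" "padicrel CARD('a) Y Y'"
  thus "padicrel CARD('a) (\<lambda>n. X n - Y n) (\<lambda>n. X' n - Y' n)"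
    using pcauchy_add[OF p, of X "\<lambda>n. - Y n"] pcauchy_add[OF p, of X' "\<lambda>n. - Y' n"]
      pcauchy_minus[OF p, of Y] pcauchy_minus[OF p, of Y']
      pnull_diff[OF p, of "\<lambda>n. X n - X' n" "\<lambda>n. Y n - Y' n"]
    by (simp add: padicrel_def algebra_simps)
qed

lift_definition times_padic :: "'a padic \<Rightarrow> 'a padic \<Rightarrow> 'a padic" is "\<lambda>X Y n. X n * Y n"
proof -
  fix X X' Y Y' :: "nat \<Rightarrow> rat"
  have p: "prime CARD('a)" by (rule prime_card)
  assume "padicrel CARD('a) X X'" "padicrel CARD('a) Y Y'"
  thus "padicrel CARD('a) (\<lambda>n. X n * Y n) (\<lambda>n. X' n * Y' n)"
    using pnull_add[OF p pnull_mult_bounded[OF p, of X "\<lambda>n. Y n - Y' n"]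
        pnull_mult_bounded[OF p, of Y' "\<lambda>n. X n - X' n"]]
    by (simp add: padicrel_def pcauchy_mult[OF p] algebra_simps)
qed

lift_definition inverse_padic :: "'a padic \<Rightarrow> 'a padic"
  is "\<lambda>X. if pnull CARD('a) X then (\<lambda>n. 0) else (\<lambda>n. inverse (X n))"
proof -
  fix X Y :: "nat \<Rightarrow> rat"
  have p: "prime CARD('a)" by (rule prime_card)
  assume rel: "padicrel CARD('a) X Y"
  hence "pnull CARD('a) X \<longleftrightarrow> pnull CARD('a) Y"
    using pnull_diff[OF p, of X "\<lambda>n. X n - Y n"] pnull_add[OF p, of "\<lambda>n. X n - Y n" Y]
    by (auto simp: padicrel_def)
  with rel show "?thesis X Y"
    by (auto simp: padicrel_def pcauchy_inverse[OF p] pnull_diff_inverse[OF p])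
qed

definition "x div y = x * inverse y" for x y :: "'a padic"

instance
proof
  fix a b c :: "'a padic"
  have p: "prime CARD('a)" by (rule prime_card)
  note simps = padicrel_def pcauchy_add[OF p] pcauchy_mult[OF p] pcauchy_minus[OF p]
  show "a + b = b + a"
    by transfer (simp add: simps add.commute)
  show "(a + b) + c = a + (b + c)"
    by transfer (simp add: simps add.assoc)
  show "0 + a = a"
    by transfer (simp add: simps)
  show "- a + a = 0"
    by transfer (simp add: simps)
  show "a - b = a + - b"
    by transfer (use pcauchy_add[OF p] pcauchy_minus[OF p] in \<open>fastforce simp: padicrel_def\<close>)
  show "(a * b) * c = a * (b * c)"
    by transfer (simp add: simps mult.assoc)
  show "a * b = b * a"
    by transfer (simp add: simps mult.commute)
  show "1 * a = a"
    by transfer (simp add: simps)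
  show "(a + b) * c = a * c + b * c"
    by transfer (simp add: simps distrib_right)
  show "(0::'a padic) \<noteq> 1"
    by transfer (simp add: padicrel_def p)
  have "pnull CARD('a) (\<lambda>n. inverse (X n) * X n - 1)"
    if X: "pcauchy CARD('a) X" "\<not> pnull CARD('a) X" for X
  proof -
    obtain b k where "b > 0" and k: "\<And>n. n \<ge> k \<Longrightarrow> rat_pabs CARD('a) (X n) > b"
      by (rule pcauchy_not_pnull[OF p X]) auto
    hence "inverse (X n) * X n - 1 = 0" if "n \<ge> k" for n
      using k[OF that] by (cases "X n = 0") auto
    hence "eventually (\<lambda>n. rat_pabs CARD('a) (inverse (X n) * X n - 1) = 0) sequentially"
      unfolding eventually_sequentially by (metis rat_pabs_0)
    thus ?thesis unfolding pnull_def by (rule tendsto_eventually)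
  qed
  thus "a \<noteq> 0 \<Longrightarrow> inverse a * a = 1"
    by transfer (auto simp: padicrel_def pcauchy_mult[OF p] pcauchy_inverse[OF p])
  show "a div b = a * inverse b"
    by (rule divide_padic_def)
  show "inverse (0::'a padic) = 0"
    by transfer (simp add: padicrel_def)
qed

end

lift_definition padic_norm :: "'a::prime_card padic \<Rightarrow> real"
  is "\<lambda>X. lim (\<lambda>n. rat_pabs CARD('a) (X n))"
proof -
  fix X Y :: "nat \<Rightarrow> rat"
  have p: "prime CARD('a)" by (rule prime_card)
  assume rel: "padicrel CARD('a) X Y"
  have "(\<lambda>n. rat_pabs CARD('a) (X n) - rat_pabs CARD('a) (Y n)) \<longlonglongrightarrow> 0"
    by (rule tendsto_0_le[of "\<lambda>n. rat_pabs CARD('a) (X n - Y n)" _ _ 1])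
       (use rel rat_pabs_reverse_triangle[OF p] in \<open>auto simp: padicrel_def pnull_def\<close>)
  from Lim_transform[OF pcauchy_convergent[OF p, of Y] this]
  show "lim (\<lambda>n. rat_pabs CARD('a) (X n)) = lim (\<lambda>n. rat_pabs CARD('a) (Y n))"
    using rel by (auto simp: padicrel_def intro: limI)
qed

lemma padic_norm_add_le_max:
  "padic_norm (x + y) \<le> max (padic_norm x) (padic_norm y)" for x y :: "'a::prime_card padic"
proof (transfer, goal_cases)
  case (1 X Y)
  have p: "prime CARD('a)" by (rule prime_card)
  have X: "pcauchy CARD('a) X" and Y: "pcauchy CARD('a) Y" using 1 by (auto simp: padicrel_def)
  note L = pcauchy_convergent[OF p]
  show ?case
    by (rule LIMSEQ_le[OF L[OF pcauchy_add[OF p X Y]] tendsto_max[OF L[OF X] L[OF Y]]])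
       (simp add: rat_pabs_add_le_max[OF p])
qed

lemma padic_norm_nonneg [simp]: "padic_norm x \<ge> 0" for x :: "'a::prime_card padic"
proof (transfer, goal_cases)
  case (1 X)
  thus ?case
    by (intro LIMSEQ_le_const[OF pcauchy_convergent[OF prime_card]]) (auto simp: padicrel_def)
qed

lemma padic_norm_eq_0_iff [simp]: "padic_norm x = 0 \<longleftrightarrow> x = 0" for x :: "'a::prime_card padic"
proof (transfer, goal_cases)
  case (1 X)
  have "lim (\<lambda>n. rat_pabs CARD('a) (X n)) = 0 \<longleftrightarrow> pnull CARD('a) X"
    using pcauchy_convergent[OF prime_card, of X] 1
    by (auto simp: padicrel_def pnull_def intro: limI)
  thus ?case using 1 by (simp add: padicrel_def)
qed

lemma padic_norm_minus [simp]: "padic_norm (- x) = padic_norm x" for x :: "'a::prime_card padic"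
  by transfer (simp add: prime_card)

instantiation padic :: (prime_card) metric_space
begin

definition dist_padic :: "'a padic \<Rightarrow> 'a padic \<Rightarrow> real" where
  "dist_padic x y = padic_norm (x - y)"

definition uniformity_padic :: "('a padic \<times> 'a padic) filter" where
  "uniformity_padic = (INF e\<in>{0 <..}. principal {(x, y). dist x y < e})"

definition open_padic :: "'a padic set \<Rightarrow> bool" where
  "open_padic U \<longleftrightarrow> (\<forall>x\<in>U. eventually (\<lambda>(x', y). x' = x \<longrightarrow> y \<in> U) uniformity)"

instance
proof
  fix x y z :: "'a padic"
  show "dist x y = 0 \<longleftrightarrow> x = y" by (simp add: dist_padic_def)
  have "padic_norm (x - y) \<le> max (padic_norm (x - z)) (padic_norm (- (y - z)))"
    using padic_norm_add_le_max[of "x - z" "- (y - z)"] by simp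
  also have "\<dots> \<le> padic_norm (x - z) + padic_norm (y - z)" unfolding padic_norm_minus by simp
  finally show "dist x y \<le> dist x z + dist y z" by (simp add: dist_padic_def)
qed (simp_all add: uniformity_padic_def open_padic_def)

end

lemma padic_norm_mult:
  "padic_norm (x * y) = padic_norm x * padic_norm y" for x y :: "'p::prime_card padic"
proof (transfer, goal_cases)
  case (1 X Y)
  have p: "prime CARD('p)" by (rule prime_card)
  have X: "pcauchy CARD('p) X" and Y: "pcauchy CARD('p) Y" using 1 by (auto simp: padicrel_def)
  note L = pcauchy_convergent[OF p]
  show ?case using tendsto_mult[OF L[OF X] L[OF Y]]
    by (intro limI) (simp add: rat_pabs_mult[OF p])
qed

lemma of_nat_padic: "of_nat m = abs_padic (\<lambda>n. of_nat m)"
proof (induction m)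
  case 0
  show ?case by (simp add: zero_padic.abs_eq)
next
  case (Suc m)
  thus ?case by (simp add: one_padic.abs_eq plus_padic.abs_eq padicrel_refl)
qed

lemma of_int_padic: "of_int m = abs_padic (\<lambda>n. of_int m)"
  by (cases m rule: int_diff_cases) (simp add: of_nat_padic minus_padic.abs_eq padicrel_refl)

lemma padic_norm_abs_padic_const:
  "padic_norm (abs_padic (\<lambda>n. q) :: 'p::prime_card padic) = rat_pabs CARD('p) q"
  by (simp add: padic_norm.abs_eq padicrel_refl)

instance padic :: (prime_card) field_char_0
proof
  have "m = n" if "of_nat m = (of_nat n :: 'a padic)" for m n
  proof -
    have "abs_padic (\<lambda>k. of_nat m - of_nat n) = (0 :: 'a padic)"
      using that by (simp add: of_nat_padic minus_padic.abs_eq padicrel_refl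
          flip: eq_iff_diff_eq_0 minus_padic.abs_eq)
    hence "rat_pabs CARD('a) (of_nat m - of_nat n) = 0"
      using padic_norm_abs_padic_const by (metis padic_norm_eq_0_iff)
    thus "m = n" by (simp add: prime_card)
  qed
  thus "inj (of_nat :: nat \<Rightarrow> 'a padic)" by (intro injI)
qed

lemma of_rat_padic: "of_rat q = abs_padic (\<lambda>n. q)"
proof (cases q)
  case (Fract a b)
  have "(abs_padic (\<lambda>n. q) :: 'a padic) * of_int b = of_int a"
    using Fract by (simp add: of_int_padic times_padic.abs_eq padicrel_refl Fract_of_int_quotient)
  thus ?thesis using Fract by (simp add: of_rat_rat field_simps)
qed

lemma padic_norm_of_rat: "padic_norm (of_rat q :: 'p::prime_card padic) = rat_pabs CARD('p) q"
  by (simp add: of_rat_padic padic_norm_abs_padic_const)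

definition padic_ord :: "'p::prime_card padic \<Rightarrow> int" where
  "padic_ord x = (THE k. padic_norm x = real CARD('p) powi (- k))"

lemma padic_norm_eq_powi_ord:
  fixes x :: "'p::prime_card padic"
  assumes "x \<noteq> 0"
  shows "padic_norm x = real CARD('p) powi (- padic_ord x)"
proof -
  have p: "prime CARD('p)" by (rule prime_card)
  have p1: "real CARD('p) > 1" using prime_gt_1_nat[OF p] by simp
  have "\<exists>k. padic_norm x = real CARD('p) powi (- k)"
    using assms
  proof (transfer, goal_cases)
    case (1 X)
    hence X: "pcauchy CARD('p) X" and nz: "\<not> pnull CARD('p) X" by (auto simp: padicrel_def)
    obtain b k where b: "b > 0" and k: "\<And>n. n \<ge> k \<Longrightarrow> rat_pabs CARD('p) (X n) > b"
      by (rule pcauchy_not_pnull[OF p X nz]) auto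
    obtain l where l: "\<And>m n. m \<ge> l \<Longrightarrow> n \<ge> l \<Longrightarrow> rat_pabs CARD('p) (X m - X n) < b"
      using pcauchyD[OF X b] by auto
    let ?N = "max k l"
    have "rat_pabs CARD('p) (X n) = rat_pabs CARD('p) (X ?N)" if "n \<ge> ?N" for n
      using rat_pabs_add_le_max[OF p, of "X n - X ?N" "X ?N"]
        rat_pabs_add_le_max[OF p, of "X ?N - X n" "X n"]
        l[of n ?N] l[of ?N n] k[of n] k[of ?N] that by auto
    hence "lim (\<lambda>n. rat_pabs CARD('p) (X n)) = rat_pabs CARD('p) (X ?N)"
      by (intro limI tendsto_eventually eventually_sequentiallyI)
    moreover have "X ?N \<noteq> 0" using k[of ?N] b by auto
    ultimately show ?case unfolding rat_pabs_def by auto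
  qed
  moreover have "k = k'"
    if "padic_norm x = real CARD('p) powi (- k)" "padic_norm x = real CARD('p) powi (- k')" for k k'
    using that power_int_strict_increasing[OF _ p1, of "- k" "- k'"]
      power_int_strict_increasing[OF _ p1, of "- k'" "- k"] by linarith
  ultimately have "\<exists>!k. padic_norm x = real CARD('p) powi (- k)" by blast
  thus ?thesis unfolding padic_ord_def by (rule theI')
qed

text \<open>\<open>padic_unit_part x\<close> is the unit \<open>|x|\<^sub>p x\<close>, with \<open>|x|\<^sub>p\<close> read as a power of \<open>p\<close> in
  the \<open>p\<close>-adic field.\<close>

definition padic_unit_part :: "'p::prime_card padic \<Rightarrow> 'p padic" where
  "padic_unit_part x = of_nat CARD('p) powi (- padic_ord x) * x"

text \<open>Reduction modulo \<open>p\<close>, only meaningful for arguments of norm at most \<open>1\<close>.\<close>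

definition padic_mod_p :: "'p::prime_card padic \<Rightarrow> int" where
  "padic_mod_p u = (THE r. r \<in> {0..<int CARD('p)} \<and> padic_norm (u - of_int r) < 1)"


section \<open>The operator and its periodic points\<close>

text \<open>Sequences \<open>(x\<^sub>n)\<close> with \<open>n \<ge> 1\<close> are indexed from \<open>0\<close> here.\<close>

definition c0 :: "(nat \<Rightarrow> 'p::prime_card padic) set" where
  "c0 = {x. x \<longlonglongrightarrow> 0}"

definition F_dom :: "(nat \<Rightarrow> 'p::prime_card padic) set" where
  "F_dom = {x \<in> c0. (\<Sum>n. x n) \<noteq> -1}"

definition F_op :: "(nat \<Rightarrow> 'p::prime_card padic) \<Rightarrow> (nat \<Rightarrow> 'p padic) \<Rightarrow> nat \<Rightarrow> 'p padic" where
  "F_op l x = (\<lambda>n. l n * (1 / (1 + (\<Sum>m. x m)))\<^sup>2)"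

definition Fix_F :: "(nat \<Rightarrow> 'p::prime_card padic) \<Rightarrow> (nat \<Rightarrow> 'p padic) set" where
  "Fix_F l = {x \<in> F_dom. F_op l x = x}"

definition Per2_F :: "(nat \<Rightarrow> 'p::prime_card padic) \<Rightarrow> (nat \<Rightarrow> 'p padic) set" where
  "Per2_F l = {x \<in> F_dom. F_op l x \<in> F_dom \<and> F_op l (F_op l x) = x} - Fix_F l"

end

theory Submission
  imports Defs
begin

text \<open>The points of period two correspond to the roots \<open>t\<close> of \<open>t\<^sup>2 - \<theta> t + \<theta>\<close>, so there are two of
  them if \<open>\<theta> (\<theta> - 4)\<close> is a square and none otherwise. By Hensel's lemma \<open>p\<^sup>k u\<close>, with a unit \<open>u\<close>
  congruent to an integer \<open>r\<close> modulo the odd prime \<open>p\<close>, is a square iff \<open>k\<close> is even and \<open>r\<close> is a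
  quadratic residue. This is applied to \<open>\<theta> (\<theta> - 4)\<close> divided by the square \<open>\<theta>\<^sup>2\<close> if \<open>\<bar>\<theta>\<bar> > 1\<close>, and
  by the square \<open>4\<close> if \<open>\<bar>\<theta>\<bar> < 1\<close> or \<open>\<bar>\<theta> - 4\<bar> < 1\<close>.\<close>

section \<open>Topology of the $p$-adic field\<close>

lemma padic_norm_1 [simp]: "padic_norm (1 :: 'p::prime_card padic) = 1"
  using padic_norm_of_rat[of 1, where 'p = 'p] by simp

lemma padic_norm_0 [simp]: "padic_norm (0 :: 'p::prime_card padic) = 0"
  by simp

lemma padic_norm_inverse: "padic_norm (inverse x) = inverse (padic_norm x)"
  for x :: "'p::prime_card padic"
proof (cases "x = 0")
  case False
  hence "padic_norm x * padic_norm (inverse x) = 1"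
    by (simp flip: padic_norm_mult)
  thus ?thesis by (rule inverse_unique[symmetric])
qed (metis inverse_zero padic_norm_eq_0_iff)

lemma padic_norm_divide: "padic_norm (x / y) = padic_norm x / padic_norm y"
  for x :: "'p::prime_card padic"
  by (simp add: divide_inverse padic_norm_mult padic_norm_inverse)

lemma padic_norm_power: "padic_norm (x ^ n) = padic_norm x ^ n"
  for x :: "'p::prime_card padic"
  by (induction n) (simp_all add: padic_norm_mult)

lemma padic_norm_power_int: "padic_norm (x powi k) = padic_norm x powi k"
  for x :: "'p::prime_card padic"
  by (simp add: power_int_def padic_norm_power padic_norm_inverse)

lemma padic_norm_diff_commute: "padic_norm (x - y) = padic_norm (y - x)"
  for x :: "'p::prime_card padic"
  using padic_norm_minus[of "x - y"] by simp

lemma padic_norm_add_less: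
  "padic_norm x < e \<Longrightarrow> padic_norm y < e \<Longrightarrow> padic_norm (x + y) < e" for x :: "'p::prime_card padic"
  using padic_norm_add_le_max[of x y] by linarith

lemma padic_norm_diff_less:
  "padic_norm x < e \<Longrightarrow> padic_norm y < e \<Longrightarrow> padic_norm (x - y) < e" for x :: "'p::prime_card padic"
  using padic_norm_add_less[of x e "- y"] by simp

text \<open>In an ultrametric every triangle is isosceles: a perturbation smaller than
  \<open>y\<close> cannot change its norm.\<close>

lemma padic_norm_eq_of_diff_less:
  fixes x :: "'p::prime_card padic"
  assumes "padic_norm (x - y) < padic_norm y"
  shows "padic_norm x = padic_norm y"
  using padic_norm_add_le_max[of "x - y" y] padic_norm_add_le_max[of "y - x" x] assms
    padic_norm_diff_commute[of x y] by simp

section \<open>Limits, density of the rationals and completeness\<close>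

lemma tendsto_padic_iff:
  "(f \<longlongrightarrow> x) F \<longleftrightarrow> ((\<lambda>n. padic_norm (f n - x)) \<longlongrightarrow> 0) F" for x :: "'p::prime_card padic"
  by (subst tendsto_dist_iff) (simp add: dist_padic_def)

text \<open>Provides \<open>tendsto_mult\<close>, used to pull constants out of series and to pass
  to the limit in squares. The bound comes from expanding the product around
  \<open>(a, b)\<close>.\<close>

instance padic :: (prime_card) topological_semigroup_mult
proof
  fix a b :: "'a padic"
  show "((\<lambda>x. fst x * snd x) \<longlongrightarrow> a * b) (nhds a \<times>\<^sub>F nhds b)"
    unfolding tendsto_padic_iff
  proof (rule tendsto_sandwich[where f = "\<lambda>_. 0"])
    let ?A = "\<lambda>z :: 'a padic \<times> 'a padic. padic_norm (fst z - a)"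
    let ?B = "\<lambda>z :: 'a padic \<times> 'a padic. padic_norm (snd z - b)"
    have A: "(?A \<longlongrightarrow> 0) (nhds a \<times>\<^sub>F nhds b)"
      unfolding tendsto_padic_iff[symmetric] by (simp add: filterlim_def filtermap_fst_prod_filter)
    have B: "(?B \<longlongrightarrow> 0) (nhds a \<times>\<^sub>F nhds b)"
      unfolding tendsto_padic_iff[symmetric] by (simp add: filterlim_def filtermap_snd_prod_filter)
    show "((\<lambda>z. ?A z * ?B z + padic_norm a * ?B z + ?A z * padic_norm b) \<longlongrightarrow> 0) (nhds a \<times>\<^sub>F nhds b)"
      by (rule tendsto_eq_intros A B refl | simp)+
    have "padic_norm (fst z * snd z - a * b) \<le> ?A z * ?B z + padic_norm a * ?B z + ?A z * padic_norm b"
      for z :: "'a padic \<times> 'a padic"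
    proof -
      have eq: "fst z * snd z - a * b
              = (fst z - a) * (snd z - b) + a * (snd z - b) + (fst z - a) * b"
        by (simp add: algebra_simps)
      have tri: "padic_norm (x + y) \<le> padic_norm x + padic_norm y" for x y :: "'a padic"
        using padic_norm_add_le_max[of x y] padic_norm_nonneg[of x] padic_norm_nonneg[of y]
        by linarith
      show ?thesis unfolding eq padic_norm_mult[symmetric]
        by (meson add_mono order_refl order_trans tri)
    qed
    thus "\<forall>\<^sub>F z in nhds a \<times>\<^sub>F nhds b. padic_norm (fst z * snd z - a * b)
        \<le> ?A z * ?B z + padic_norm a * ?B z + ?A z * padic_norm b"
      by (intro always_eventually) blast
  qed auto
qed

text \<open>The distance from \<open>X n\<close> to the class of \<open>X\<close> is the limit over
  \<open>m\<close> of the norms of \<open>X n - X m\<close>, which is small by the Cauchy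
  property.\<close>

lemma of_rat_tendsto_abs_padic:
  assumes X: "pcauchy CARD('p) X"
  shows "(\<lambda>n. of_rat (X n)) \<longlonglongrightarrow> (abs_padic X :: 'p::prime_card padic)"
proof (rule metric_LIMSEQ_I)
  fix e :: real assume e: "e > 0"
  have p: "prime CARD('p)" by (rule prime_card)
  \<comment> \<open>Half of \<open>e\<close> is used because the limit turns the strict bound into a
    weak one.\<close>
  have "e / 2 > 0" using e by simp
  then obtain k where k: "\<And>m n. m \<ge> k \<Longrightarrow> n \<ge> k \<Longrightarrow> rat_pabs CARD('p) (X m - X n) < e / 2"
    using pcauchyD[OF X] by blast
  have "dist (of_rat (X n)) (abs_padic X :: 'p padic) < e" if n: "n \<ge> k" for n
  proof -
    let ?Y = "\<lambda>m. X n - X m"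
    have Y: "pcauchy CARD('p) ?Y"
      using pcauchy_add[OF p pcauchy_const pcauchy_minus[OF p X]] by simp
    have "of_rat (X n) - (abs_padic X :: 'p padic) = abs_padic ?Y"
      unfolding of_rat_padic by (simp add: minus_padic.abs_eq padicrel_refl X)
    hence "dist (of_rat (X n)) (abs_padic X :: 'p padic) = lim (\<lambda>m. rat_pabs CARD('p) (?Y m))"
      by (simp add: dist_padic_def padic_norm.abs_eq padicrel_refl Y)
    also have "\<dots> \<le> e / 2"
      by (rule LIMSEQ_le_const2[OF pcauchy_convergent[OF p Y]])
        (use k[OF n] in \<open>auto intro: less_imp_le\<close>)
    also have "\<dots> < e" using e by simp
    finally show ?thesis .
  qed
  thus "\<exists>no. \<forall>n\<ge>no. dist (of_rat (X n)) (abs_padic X :: 'p padic) < e" by blast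
qed

lemma of_rat_dense_padic:
  fixes x :: "'p::prime_card padic"
  assumes "e > 0"
  obtains q where "padic_norm (x - of_rat q) < e"
proof -
  define X where "X = rep_padic x"
  have X: "pcauchy CARD('p) X" "abs_padic X = x"
    using Quotient_rep_reflp[OF Quotient_padic, of x] Quotient_abs_rep[OF Quotient_padic, of x]
    by (auto simp: X_def padicrel_def)
  from metric_LIMSEQ_D[OF of_rat_tendsto_abs_padic[OF X(1)] assms] obtain n
    where "dist (of_rat (X n)) x < e" using X(2) by blast
  thus thesis using that by (simp add: dist_padic_def padic_norm_diff_commute)
qed

text \<open>Diagonal argument: each \<open>x n\<close> is replaced by a rational \<open>q n\<close>
  closer than \<open>1 / (n + 1)\<close>. Then \<open>q\<close> is Cauchy too, and the class of
  \<open>q\<close> is the limit of both sequences.\<close>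

instance padic :: (prime_card) complete_space
proof
  fix x :: "nat \<Rightarrow> 'a padic" assume x: "Cauchy x"
  have "\<exists>q. padic_norm (x n - of_rat q) < inverse (real (Suc n))" for n
    by (metis of_rat_dense_padic inverse_positive_iff_positive of_nat_0_less_iff zero_less_Suc)
  then obtain q where q: "\<And>n. padic_norm (x n - of_rat (q n)) < inverse (real (Suc n))"
    by metis
  have lim: "(\<lambda>n. padic_norm (x n - of_rat (q n))) \<longlonglongrightarrow> 0"
    by (rule tendsto_sandwich[OF _ _ tendsto_const LIMSEQ_inverse_real_of_nat])
      (use q in \<open>auto intro!: always_eventually less_imp_le\<close>)
  have "pcauchy CARD('a) q"
    unfolding pcauchy_def
  proof (intro allI impI)
    fix e :: real assume e: "e > 0"
    obtain k where k: "\<And>m n. m \<ge> k \<Longrightarrow> n \<ge> k \<Longrightarrow> padic_norm (x m - x n) < e"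
      using metric_CauchyD[OF x e] by (auto simp: dist_padic_def)
    obtain l where l: "\<And>n. n \<ge> l \<Longrightarrow> padic_norm (x n - of_rat (q n)) < e"
      using order_tendstoD(2)[OF lim e] by (auto simp: eventually_sequentially)
    have "rat_pabs CARD('a) (q m - q n) < e" if "m \<ge> max k l" "n \<ge> max k l" for m n
    proof -
      have eq: "of_rat (q m - q n) = (x m - x n) + (x n - of_rat (q n)) - (x m - of_rat (q m))"
        by (simp add: of_rat_diff)
      have "padic_norm (of_rat (q m - q n) :: 'a padic) < e"
        unfolding eq using that by (intro padic_norm_diff_less padic_norm_add_less k l) auto
      thus ?thesis by (simp add: padic_norm_of_rat)
    qed
    thus "\<exists>k. \<forall>m\<ge>k. \<forall>n\<ge>k. rat_pabs CARD('a) (q m - q n) < e" by blast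
  qed
  from of_rat_tendsto_abs_padic[OF this]
  have Q: "(\<lambda>n. dist (of_rat (q n)) (abs_padic q :: 'a padic)) \<longlonglongrightarrow> 0"
    by (simp flip: tendsto_dist_iff)
  have "(\<lambda>n. padic_norm (x n - of_rat (q n)) + dist (of_rat (q n)) (abs_padic q :: 'a padic)) \<longlonglongrightarrow> 0"
    using tendsto_add[OF lim Q] by simp
  hence "(\<lambda>n. dist (x n) (abs_padic q)) \<longlonglongrightarrow> 0"
    by (rule tendsto_sandwich[OF _ _ tendsto_const, rotated 2])
      (auto intro!: always_eventually simp: dist_triangle simp flip: dist_padic_def)
  thus "convergent x" by (auto simp: convergent_def simp flip: tendsto_dist_iff)
qed

section \<open>Convergence of series\<close>

text \<open>A difference of distant terms is a sum of consecutive differences, so the ultrametric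
  inequality bounds it by the largest of them.\<close>

lemma padic_CauchyI:
  fixes X :: "nat \<Rightarrow> 'p::prime_card padic"
  assumes "(\<lambda>n. padic_norm (X (Suc n) - X n)) \<longlonglongrightarrow> 0"
  shows "Cauchy X"
proof (rule metric_CauchyI)
  fix e :: real assume e: "e > 0"
  obtain k where k: "\<And>n. n \<ge> k \<Longrightarrow> padic_norm (X (Suc n) - X n) < e"
    using order_tendstoD(2)[OF assms e] by (auto simp: eventually_sequentially)
  have "padic_norm (X n - X k) < e" if "n \<ge> k" for n
    using that
  proof (induction n rule: dec_induct)
    case base
    thus ?case using e by simp
  next
    case (step n)
    thus ?case using padic_norm_add_less[OF k[of n] step.IH] by simp
  qed
  hence "dist (X m) (X n) < e" if "m \<ge> k" "n \<ge> k" for m n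
    using padic_norm_diff_less[of "X m - X k" e "X n - X k"] that by (simp add: dist_padic_def)
  thus "\<exists>M. \<forall>m\<ge>M. \<forall>n\<ge>M. dist (X m) (X n) < e" by blast
qed

text \<open>Consecutive partial sums differ by a single term, which tends to 0. Hence the sums in
  \<open>F_op\<close> and \<open>F_dom\<close> are genuine limits, not default values of
  \<open>suminf\<close>.\<close>

lemma summable_c0:
  fixes x :: "nat \<Rightarrow> 'p::prime_card padic"
  assumes "x \<in> c0" shows "summable x"
  unfolding summable_iff_convergent
  by (intro Cauchy_convergent padic_CauchyI) (use assms in \<open>simp add: c0_def tendsto_padic_iff\<close>)

lemma padic_sums_mult:
  fixes x :: "nat \<Rightarrow> 'p::prime_card padic"
  assumes "x sums s" shows "(\<lambda>n. x n * c) sums (s * c)"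
  using tendsto_mult[OF assms[unfolded sums_def] tendsto_const[of c]]
  by (simp add: sums_def sum_distrib_right)

section \<open>Residues and squares\<close>

lemma rat_pabs_of_int:
  assumes p: "prime p"
  shows "rat_pabs p (of_int k) \<le> 1" and "rat_pabs p (of_int k) < 1 \<longleftrightarrow> int p dvd k"
proof -
  have ord: "rat_ord p (of_int k) = int (multiplicity (int p) k)"
    by (simp add: rat_ord_def)
  have p1: "real p > 1" using prime_gt_1_nat[OF p] by simp
  have *: "rat_pabs p (of_int k) = inverse (real p ^ multiplicity (int p) k)" if "k \<noteq> 0"
    using that by (simp add: rat_pabs_def ord power_int_minus)
  show "rat_pabs p (of_int k) \<le> 1"
    using * p1 by (cases "k = 0") (simp_all add: inverse_le_1_iff)
  show "rat_pabs p (of_int k) < 1 \<longleftrightarrow> int p dvd k"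
  proof (cases "k = 0")
    case False
    have "rat_pabs p (of_int k) < 1 \<longleftrightarrow> 1 < real p ^ multiplicity (int p) k"
      unfolding *[OF False] using p1 by (simp add: field_simps)
    also have "\<dots> \<longleftrightarrow> multiplicity (int p) k > 0"
      using p1 by (metis less_irrefl not_gr_zero one_less_power power_0)
    also have "\<dots> \<longleftrightarrow> int p dvd k"
      using False p by (intro multiplicity_gt_zero_iff) auto
    finally show ?thesis .
  qed simp
qed

lemma padic_norm_of_int:
  "padic_norm (of_int k :: 'p::prime_card padic) \<le> 1"
  "padic_norm (of_int k :: 'p padic) < 1 \<longleftrightarrow> int CARD('p) dvd k"
  using rat_pabs_of_int[OF prime_card[where 'a = 'p], of k]
    padic_norm_of_rat[of "of_int k", where 'p = 'p] by simp_all

lemma padic_norm_of_int_eq_1_iff: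
  "padic_norm (of_int k :: 'p::prime_card padic) = 1 \<longleftrightarrow> \<not> int CARD('p) dvd k"
  using padic_norm_of_int[of k, where 'p = 'p] by linarith

lemma padic_norm_card: "padic_norm (of_nat CARD('p) :: 'p::prime_card padic) = inverse (real CARD('p))"
proof -
  have p: "prime CARD('p)" by (rule prime_card)
  have "rat_ord CARD('p) (of_nat CARD('p)) = 1"
    using p rat_ord_def[of "CARD('p)" "of_int (int CARD('p))"] by (simp add: quotient_of_int)
  thus ?thesis using padic_norm_of_rat[of "of_nat CARD('p)", where 'p = 'p] p
    by (simp add: rat_pabs_def power_int_minus)
qed

lemma padic_ord_unique:
  fixes x :: "'p::prime_card padic"
  assumes "padic_norm x = real CARD('p) powi (- k)"
  shows "padic_ord x = k"
proof -
  have p1: "real CARD('p) > 1" using prime_gt_1_nat[OF prime_card[where 'a = 'p]] by simp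
  have "x \<noteq> 0" using assms p1 by auto
  from padic_norm_eq_powi_ord[OF this] assms show ?thesis
    using power_int_strict_increasing[OF _ p1, of "- k" "- padic_ord x"]
      power_int_strict_increasing[OF _ p1, of "- padic_ord x" "- k"] by linarith
qed

lemma padic_unit_part:
  fixes x :: "'p::prime_card padic"
  assumes "x \<noteq> 0"
  shows "padic_norm (padic_unit_part x) = 1"
    and "x = of_nat CARD('p) powi padic_ord x * padic_unit_part x"
proof -
  have p0: "CARD('p) \<noteq> 0" using prime_gt_0_nat[OF prime_card[where 'a = 'p]] by simp
  show "padic_norm (padic_unit_part x) = 1"
    using p0 padic_norm_eq_powi_ord[OF assms]
    by (simp add: padic_unit_part_def padic_norm_mult padic_norm_power_int padic_norm_card
        padic_norm_inverse power_int_minus power_int_inverse)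
  show "x = of_nat CARD('p) powi padic_ord x * padic_unit_part x"
    using p0 by (simp add: padic_unit_part_def power_int_minus)
qed

section \<open>Reduction modulo \<open>p\<close>\<close>

lemma padic_residue_unique:
  fixes u :: "'p::prime_card padic"
  assumes "padic_norm (u - of_int a) < 1" "padic_norm (u - of_int b) < 1"
  shows "[a = b] (mod int CARD('p))"
proof -
  have "padic_norm (of_int (a - b) :: 'p padic) < 1"
    using padic_norm_diff_less[OF assms(2,1)] by simp
  thus ?thesis unfolding padic_norm_of_int by (simp add: cong_iff_dvd_diff)
qed

text \<open>Write \<open>u v - a b\<close> as \<open>(u - a) v + a (v - b)\<close>, where
  \<open>v\<close> and \<open>a\<close> have norm at most 1.\<close>

lemma padic_residue_mult:
  fixes u v :: "'p::prime_card padic"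
  assumes "padic_norm (u - of_int a) < 1" "padic_norm (v - of_int b) < 1"
  shows "padic_norm (u * v - of_int (a * b)) < 1"
proof -
  have "padic_norm v \<le> 1"
    using padic_norm_add_le_max[of "v - of_int b" "of_int b"] padic_norm_of_int(1)[of b, where 'p = 'p]
      assms(2) by simp
  hence 1: "padic_norm ((u - of_int a) * v) < 1"
    using assms(1) mult_left_mono[of "padic_norm v" 1 "padic_norm (u - of_int a)"]
    by (simp add: padic_norm_mult)
  have 2: "padic_norm (of_int a * (v - of_int b)) < 1"
    using assms(2) padic_norm_of_int(1)[of a, where 'p = 'p]
      mult_right_mono[of "padic_norm (of_int a :: 'p padic)" 1 "padic_norm (v - of_int b)"]
    by (simp add: padic_norm_mult)
  show ?thesis using padic_norm_add_less[OF 1 2] by (simp add: algebra_simps)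
qed

text \<open>Approximate \<open>u\<close> by a fraction \<open>a / b\<close> in lowest terms. Its
  norm is at most 1, so \<open>p\<close> does not divide \<open>b\<close>, and \<open>a\<close>
  times an inverse of \<open>b\<close> modulo \<open>p\<close> is the residue.\<close>

lemma padic_residue_exists:
  fixes u :: "'p::prime_card padic"
  assumes "padic_norm u \<le> 1"
  obtains r where "r \<in> {0..<int CARD('p)}" "padic_norm (u - of_int r) < 1"
proof -
  let ?p = "int CARD('p)"
  have p: "prime CARD('p)" by (rule prime_card)
  obtain q where q: "padic_norm (u - of_rat q) < 1"
    using of_rat_dense_padic[of 1 u] by auto
  obtain a b where ab: "q = Rat.Fract a b" "b > 0" "coprime a b" by (cases q)
  have nb: "\<not> ?p dvd b"
  \<comment> \<open>Otherwise \<open>a\<close> would be a unit, although its norm is that of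
    \<open>q\<close> times that of \<open>b\<close>, which is below 1.\<close>
  proof
    assume pb: "?p dvd b"
    hence "\<not> ?p dvd a" using coprime_common_divisor[OF ab(3) _ pb] p by auto
    hence na: "padic_norm (of_int a :: 'p padic) = 1" by (simp add: padic_norm_of_int_eq_1_iff)
    have "padic_norm (of_rat q :: 'p padic) \<le> 1"
      using padic_norm_add_le_max[of "of_rat q - u" u] q assms padic_norm_diff_commute[of u "of_rat q"]
      by simp
    moreover have "(of_int a :: 'p padic) = of_rat q * of_int b"
      using ab by (simp add: of_rat_rat)
    hence "1 = padic_norm (of_rat q :: 'p padic) * padic_norm (of_int b :: 'p padic)"
      using na padic_norm_mult by metis
    ultimately show False using pb padic_norm_of_int(2)[of b, where 'p = 'p]
      mult_right_mono[of "padic_norm (of_rat q :: 'p padic)" 1 "padic_norm (of_int b :: 'p padic)"]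
      by simp
  qed
  hence "coprime b ?p"
    using p prime_imp_coprime[of ?p b] by (simp add: coprime_commute)
  then obtain c where c: "[b * c = 1] (mod ?p)" using cong_solve_coprime_int by blast
  define r where "r = (a * c) mod ?p"
  have "[b * r = a] (mod ?p)"
    using cong_scalar_left[OF c, of a] unfolding r_def
    by (simp add: cong_def mod_mult_right_eq ac_simps)
  hence "padic_norm (of_int (a - b * r) :: 'p padic) < 1"
    unfolding padic_norm_of_int(2) using cong_iff_dvd_diff cong_sym by blast
  moreover have "of_int (a - b * r) = (of_rat q - of_int r) * (of_int b :: 'p padic)"
    using ab by (simp add: of_rat_rat algebra_simps)
  moreover have "padic_norm (of_int b :: 'p padic) = 1"
    using nb by (simp add: padic_norm_of_int_eq_1_iff)
  ultimately have "padic_norm (of_rat q - of_int r :: 'p padic) < 1"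
    by (simp add: padic_norm_mult)
  hence "padic_norm (u - of_int r) < 1" using padic_norm_add_less[OF q] by fastforce
  moreover have "r \<in> {0..<?p}" using p by (simp add: r_def prime_gt_0_nat)
  ultimately show thesis using that by blast
qed

lemma padic_mod_p:
  fixes u :: "'p::prime_card padic"
  assumes "padic_norm u \<le> 1"
  shows "padic_norm (u - of_int (padic_mod_p u)) < 1"
proof -
  have "\<exists>!r. r \<in> {0..<int CARD('p)} \<and> padic_norm (u - of_int r) < 1"
  proof (rule ex_ex1I)
    show "\<exists>r. r \<in> {0..<int CARD('p)} \<and> padic_norm (u - of_int r) < 1"
      by (rule padic_residue_exists[OF assms]) blast
  next
    fix a b
    assume "a \<in> {0..<int CARD('p)} \<and> padic_norm (u - of_int a) < 1"
      and "b \<in> {0..<int CARD('p)} \<and> padic_norm (u - of_int b) < 1"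
    thus "a = b" using padic_residue_unique[of u a b] by (auto intro: cong_less_imp_eq_int)
  qed
  from theI'[OF this] show ?thesis by (simp add: padic_mod_p_def)
qed

section \<open>Hensel's lemma and squares\<close>

text \<open>Newton iteration for \<open>z\<^sup>2 - u\<close>. As 2 and all iterates are units, each
  step squares the norm of the error, and an iterate moves by exactly the norm of its error; so the
  iterates are Cauchy.\<close>

lemma padic_hensel_sqrt:
  fixes u :: "'p::prime_card padic"
  assumes odd: "CARD('p) \<noteq> 2" and a: "padic_norm a = 1" and ua: "padic_norm (a\<^sup>2 - u) < 1"
  obtains z where "z\<^sup>2 = u"
proof -
  define h where "h = (\<lambda>z. z - (z\<^sup>2 - u) / (2 * z))"
  define X where "X = (\<lambda>n. (h ^^ n) a)"
  define q where "q = padic_norm (a\<^sup>2 - u)"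
  have q: "0 \<le> q" "q < 1" using ua by (simp_all add: q_def)
  have "\<not> CARD('p) dvd 2"
    using odd primes_dvd_imp_eq[OF prime_card[where 'a = 'p] two_is_prime_nat] by blast
  hence "\<not> int CARD('p) dvd 2" by (metis int_dvd_int_iff of_nat_numeral)
  hence n2: "padic_norm (2 :: 'p padic) = 1"
    using padic_norm_of_int_eq_1_iff[of 2, where 'p = 'p] by simp
  have X: "padic_norm (X n) = 1 \<and> padic_norm ((X n)\<^sup>2 - u) \<le> q ^ Suc n" for n
  proof (induction n)
    case 0
    thus ?case using a by (simp add: X_def q_def)
  next
    case (Suc n)
    define z where "z = X n"
    have Xs: "X (Suc n) = h z" by (simp add: X_def z_def)
    have z1: "padic_norm z = 1" and zq: "padic_norm (z\<^sup>2 - u) \<le> q ^ Suc n"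
      using Suc by (auto simp: z_def)
    have z0: "z \<noteq> 0" using z1 by auto
    have q1: "q ^ Suc n < 1" using q by (metis power_less_one_iff zero_less_Suc)
    have "(h z)\<^sup>2 - u = ((z\<^sup>2 - u) / (2 * z))\<^sup>2"
      using z0 by (simp add: h_def field_simps power2_eq_square)
    hence "padic_norm ((h z)\<^sup>2 - u) = (padic_norm (z\<^sup>2 - u))\<^sup>2"
      using z1 n2 by (simp add: padic_norm_power padic_norm_divide padic_norm_mult)
    also have "\<dots> \<le> (q ^ Suc n)\<^sup>2" using zq by (intro power_mono) auto
    also have "\<dots> = q ^ (2 * Suc n)" by (metis power_even_eq)
    \<comment> \<open>Quadratic convergence is weakened to a geometric rate, which suffices for the
      limit.\<close>
    also have "\<dots> \<le> q ^ Suc (Suc n)" using q by (intro power_decreasing) auto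
    finally have "padic_norm ((h z)\<^sup>2 - u) \<le> q ^ Suc (Suc n)" .
    moreover have "padic_norm (h z - z) < padic_norm z"
      using z1 n2 zq q1 by (simp add: h_def padic_norm_divide padic_norm_mult)
    hence "padic_norm (h z) = 1" using z1 padic_norm_eq_of_diff_less by metis
    ultimately show ?case using Xs by simp
  qed
  have lim: "(\<lambda>n. padic_norm ((X n)\<^sup>2 - u)) \<longlonglongrightarrow> 0"
    by (rule tendsto_sandwich[OF _ _ tendsto_const LIMSEQ_Suc[OF LIMSEQ_realpow_zero[OF q]]])
      (use X in \<open>auto intro!: always_eventually\<close>)
  have "padic_norm (X (Suc n) - X n) = padic_norm ((X n)\<^sup>2 - u)" for n
    using X[of n] n2 by (simp add: X_def h_def padic_norm_divide padic_norm_mult)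
  hence "Cauchy X" using lim by (intro padic_CauchyI) simp
  then obtain z where "X \<longlonglongrightarrow> z" using Cauchy_convergent convergent_def by blast
  hence "(\<lambda>n. (X n)\<^sup>2) \<longlonglongrightarrow> z\<^sup>2" unfolding power2_eq_square by (intro tendsto_mult)
  moreover have "(\<lambda>n. (X n)\<^sup>2) \<longlonglongrightarrow> u" using lim by (simp add: tendsto_padic_iff)
  ultimately show thesis using LIMSEQ_unique that by blast
qed

text \<open>A square root of \<open>u\<close> is a unit whose residue is a square root of
  \<open>r\<close> modulo \<open>p\<close>. Conversely, a root modulo \<open>p\<close> is a starting
  value for the Newton iteration.\<close>

lemma padic_unit_square_iff:
  fixes u :: "'p::prime_card padic"
  assumes odd: "CARD('p) \<noteq> 2" and r: "\<not> int CARD('p) dvd r" and ur: "padic_norm (u - of_int r) < 1"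
  shows "(\<exists>z. z\<^sup>2 = u) \<longleftrightarrow> QuadRes (int CARD('p)) r"
proof
  have r1: "padic_norm (of_int r :: 'p padic) = 1" using r by (simp add: padic_norm_of_int_eq_1_iff)
  {
    assume "\<exists>z. z\<^sup>2 = u"
    then obtain z where z: "z\<^sup>2 = u" ..
    have "padic_norm u = 1" using padic_norm_eq_of_diff_less[of u "of_int r"] ur r1 by simp
    hence "(padic_norm z)\<^sup>2 = 1" using z by (simp flip: padic_norm_power)
    hence "padic_norm z \<le> 1" by (auto simp: power2_eq_1_iff)
    then obtain s where "padic_norm (z - of_int s) < 1" using padic_residue_exists by blast
    from padic_residue_mult[OF this this] have "padic_norm (u - of_int (s * s)) < 1"
      using z by (simp add: power2_eq_square)
    from padic_residue_unique[OF this ur] show "QuadRes (int CARD('p)) r"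
      by (auto simp: QuadRes_def power2_eq_square)
  next
    assume "QuadRes (int CARD('p)) r"
    then obtain y where y: "[y\<^sup>2 = r] (mod int CARD('p))" by (auto simp: QuadRes_def)
    have "padic_norm (of_int (y\<^sup>2 - r) :: 'p padic) < 1"
      using y unfolding padic_norm_of_int(2) by (simp add: cong_iff_dvd_diff)
    hence *: "padic_norm ((of_int y)\<^sup>2 - u) < 1"
      using padic_norm_diff_less[OF _ ur, of "of_int (y\<^sup>2 - r)"] by simp
    have "\<not> int CARD('p) dvd y"
      using y r by (metis cong_dvd_iff dvd_mult power2_eq_square)
    hence "padic_norm (of_int y :: 'p padic) = 1" by (simp add: padic_norm_of_int_eq_1_iff)
    from padic_hensel_sqrt[OF odd this *] show "\<exists>z. z\<^sup>2 = u" by metis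
  }
qed

lemma square_mult_iff:
  fixes c x :: "'a::field"
  assumes "c \<noteq> 0"
  shows "(\<exists>z. z\<^sup>2 = c\<^sup>2 * x) \<longleftrightarrow> (\<exists>z. z\<^sup>2 = x)"
proof
  assume "\<exists>z. z\<^sup>2 = c\<^sup>2 * x"
  then obtain z where "z\<^sup>2 = c\<^sup>2 * x" ..
  hence "(z / c)\<^sup>2 = x" using assms by (simp add: power_divide)
  thus "\<exists>z. z\<^sup>2 = x" ..
next
  assume "\<exists>z. z\<^sup>2 = x"
  then obtain z where "z\<^sup>2 = x" ..
  hence "(c * z)\<^sup>2 = c\<^sup>2 * x" by (simp add: power_mult_distrib)
  thus "\<exists>z. z\<^sup>2 = c\<^sup>2 * x" ..
qed

text \<open>An even power of \<open>p\<close> is a square and can be split off. For odd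
  \<open>k\<close> there is no root, because the order of a nonzero square is even.\<close>

lemma padic_square_iff:
  fixes u :: "'p::prime_card padic"
  assumes odd: "CARD('p) \<noteq> 2" and r: "\<not> int CARD('p) dvd r" and ur: "padic_norm (u - of_int r) < 1"
  shows "(\<exists>z. z\<^sup>2 = of_nat CARD('p) powi k * u) \<longleftrightarrow> even k \<and> QuadRes (int CARD('p)) r"
proof -
  have p0: "(of_nat CARD('p) :: 'p padic) \<noteq> 0"
    using prime_gt_0_nat[OF prime_card[where 'a = 'p]] by simp
  have r1: "padic_norm (of_int r :: 'p padic) = 1" using r by (simp add: padic_norm_of_int_eq_1_iff)
  have u1: "padic_norm u = 1" using padic_norm_eq_of_diff_less[of u "of_int r"] ur r1 by simp
  show ?thesis
  proof (cases "even k")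
    case True
    then obtain m where m: "k = m * 2" by (auto elim: evenE)
    have "of_nat CARD('p) powi k = (of_nat CARD('p) powi m :: 'p padic)\<^sup>2"
      unfolding m by (simp add: power_int_mult)
    thus ?thesis using square_mult_iff[of "of_nat CARD('p) powi m" u] p0
        padic_unit_square_iff[OF odd r ur] True by simp
  next
    case False
    have False if z: "z\<^sup>2 = of_nat CARD('p) powi k * u" for z :: "'p padic"
    proof -
      have nz: "padic_norm (z\<^sup>2) = real CARD('p) powi (- k)"
        unfolding z by (simp add: padic_norm_mult padic_norm_power_int padic_norm_card u1
            power_int_minus power_int_inverse)
      have "z \<noteq> 0" using nz p0 by auto
      hence "padic_norm (z\<^sup>2) = real CARD('p) powi (- (padic_ord z * 2))"
        by (simp add: padic_norm_power padic_norm_eq_powi_ord power_int_mult power_int_minus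
            flip: power_inverse)
      with padic_ord_unique[OF nz] padic_ord_unique[of "z\<^sup>2"] have "k = padic_ord z * 2" by metis
      thus False using False by simp
    qed
    thus ?thesis using False by blast
  qed
qed

text \<open>The term at \<open>j\<close> has norm at most \<open>1 / p ^ j\<close>, so every term
  after the first vanishes modulo \<open>p\<close>, and a partial sum close to the limit transfers
  this to the series.\<close>

lemma padic_digit_series_residue:
  fixes d :: "nat \<Rightarrow> nat"
  shows "padic_norm ((\<Sum>j. of_nat (d j) * of_nat CARD('p) ^ j) - of_int (int (d 0)) :: 'p::prime_card padic) < 1"
proof -
  let ?f = "\<lambda>j. of_nat (d j) * of_nat CARD('p) ^ j :: 'p padic"
  let ?q = "inverse (real CARD('p))"
  have p1: "real CARD('p) > 1" using prime_gt_1_nat[OF prime_card[where 'a = 'p]] by simp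
  have q: "0 \<le> ?q" "?q < 1" "0 < ?q" using p1 by (simp_all add: field_simps)
  have f: "padic_norm (?f j) \<le> ?q ^ j" for j
    using padic_norm_of_int(1)[of "int (d j)", where 'p = 'p] q
      mult_right_mono[of "padic_norm (of_nat (d j) :: 'p padic)" 1 "?q ^ j"]
    by (simp add: padic_norm_mult padic_norm_power padic_norm_card del: power_inverse)
  have "(\<lambda>j. padic_norm (?f j)) \<longlonglongrightarrow> 0"
    by (rule tendsto_sandwich[OF _ _ tendsto_const LIMSEQ_realpow_zero[OF q(1,2)]])
      (use f in \<open>auto intro!: always_eventually\<close>)
  hence "?f \<in> c0" by (simp add: c0_def tendsto_padic_iff)
  \<comment> \<open>The bound \<open>Suc n\<close> keeps the term \<open>j = 0\<close> in every
    partial sum.\<close>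
  hence "(\<lambda>n. \<Sum>j<Suc n. ?f j) \<longlonglongrightarrow> suminf ?f"
    using summable_LIMSEQ[OF summable_c0] LIMSEQ_Suc by blast
  from metric_LIMSEQ_D[OF this zero_less_one] obtain n
    where n: "padic_norm ((\<Sum>j<Suc n. ?f j) - suminf ?f) < 1" by (auto simp: dist_padic_def)
  have "padic_norm ((\<Sum>j<Suc n. ?f j) - of_int (int (d 0))) < 1"
  proof (induction n)
    case (Suc n)
    have "padic_norm (?f (Suc n)) < 1"
      using f[of "Suc n"] q power_Suc_less_one[OF q(3,2), of n] by linarith
    from padic_norm_add_less[OF Suc this] show ?case by (simp add: algebra_simps)
  qed simp
  from padic_norm_diff_less[OF this n] show ?thesis by simp
qed

section \<open>Periodic points\<close>

text \<open>Each value of \<open>F_op l\<close> is a constant multiple of \<open>l\<close>, so this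
  gives its membership in \<open>c0\<close> and its sum.\<close>

lemma c0_mult_const:
  fixes l :: "nat \<Rightarrow> 'p::prime_card padic"
  assumes "l \<in> c0" shows "(\<lambda>n. l n * c) \<in> c0" and "(\<Sum>n. l n * c) = (\<Sum>n. l n) * c"
  using tendsto_mult[OF _ tendsto_const[of c], of l 0] assms
    sums_unique[OF padic_sums_mult[OF summable_sums[OF summable_c0[OF assms]], of c]]
  by (simp_all add: c0_def)

text \<open>With \<open>s = 1 + \<Sum>x\<close> and \<open>t = 1 + \<Sum>F x\<close>, a point of period two satisfies
  \<open>s\<^sup>2 t = s\<^sup>2 + \<theta>\<close> and \<open>s t\<^sup>2 = t\<^sup>2 + \<theta>\<close>; for \<open>s \<noteq> t\<close> this amounts to \<open>s + t = s t = \<theta>\<close>.\<close>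

lemma two_cycle_sum_product:
  fixes s t \<theta> :: "'a::field"
  assumes "s \<noteq> 0" "t \<noteq> 0" "s \<noteq> t" "t = 1 + \<theta> * (1 / s)\<^sup>2" "s = 1 + \<theta> * (1 / t)\<^sup>2"
  shows "s + t = \<theta>" "s * t = \<theta>"
proof -
  have 1: "s\<^sup>2 * t = s\<^sup>2 + \<theta>" and 2: "s * t\<^sup>2 = t\<^sup>2 + \<theta>"
    by (subst assms(4), simp add: assms(1) distrib_left power_divide,
        subst assms(5), simp add: assms(2) distrib_right power_divide)
  \<comment> \<open>The difference of the two cycle equations, factored; then \<open>s - t\<close>
    cancels.\<close>
  have "(s - t) * (s * t) = (s - t) * (s + t)"
    using 1 2 by (simp add: algebra_simps power2_eq_square)
  hence st: "s * t = s + t" using assms(3) by simp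
  \<comment> \<open>Insert \<open>s t = s + t\<close> into the first equation and compare.\<close>
  have "s\<^sup>2 * t = s * (s * t)" by (simp add: power2_eq_square)
  also have "\<dots> = s\<^sup>2 + s * t" unfolding st by (simp add: algebra_simps power2_eq_square st)
  finally show "s * t = \<theta>" using 1 by simp
  thus "s + t = \<theta>" using st by simp
qed

text \<open>\<open>F_op l x\<close> depends only on \<open>1 + suminf x\<close>, and
  \<open>g t\<close> is its value when this number is \<open>t\<close>. On the set \<open>R\<close>
  of roots, \<open>F_op l\<close> sends \<open>g t\<close> to \<open>g (\<theta> - t)\<close>, so it
  acts as the exchange of the two roots.\<close>

lemma Per2_F_eq_image:
  fixes l :: "nat \<Rightarrow> 'p::prime_card padic"
  assumes l: "l \<in> c0" and \<theta>: "\<theta> = (\<Sum>n. l n)" "\<theta> \<noteq> 0" "\<theta> \<noteq> 4"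
  defines "g \<equiv> \<lambda>t n. l n * (1 / t)\<^sup>2" and "R \<equiv> {t. t\<^sup>2 - \<theta> * t + \<theta> = 0}"
  shows "Per2_F l = g ` R" and "inj_on g R"
proof -
  have gc: "g t \<in> c0" and gs: "suminf (g t) = \<theta> * (1 / t)\<^sup>2" for t
    using c0_mult_const[OF l] by (simp_all add: g_def \<theta>)
  have F: "F_op l x = g (1 + suminf x)" for x
    by (simp add: F_op_def g_def)
  have dom: "x \<in> F_dom \<longleftrightarrow> x \<in> c0 \<and> 1 + suminf x \<noteq> 0" for x :: "nat \<Rightarrow> 'p padic"
    by (auto simp: F_dom_def add_eq_0_iff)
  have R: "t \<noteq> 0" "1 + suminf (g t) = \<theta> - t" "\<theta> - t \<in> R" "\<theta> - t \<noteq> t" if "t \<in> R" for t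
  proof -
    have t: "t\<^sup>2 - \<theta> * t + \<theta> = 0" using that by (simp add: R_def)
    show t0: "t \<noteq> 0" using t \<theta> by auto
    \<comment> \<open>The cofactor \<open>t + 1\<close> exhibits the two cubic expressions as
      congruent modulo the quadratic.\<close>
    have "t\<^sup>2 + \<theta> = (\<theta> - t) * t\<^sup>2 + (t + 1) * (t\<^sup>2 - \<theta> * t + \<theta>) "
      by (simp add: algebra_simps power2_eq_square)
    hence h: "t\<^sup>2 + \<theta> = (\<theta> - t) * t\<^sup>2" using t by simp
    have "1 + suminf (g t) = (t\<^sup>2 + \<theta>) / t\<^sup>2"
      using t0 by (simp add: gs add_divide_distrib power_divide)
    thus "1 + suminf (g t) = \<theta> - t"
      using t0 by (simp add: h)
    show "\<theta> - t \<in> R"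
      using t by (simp add: R_def algebra_simps power2_eq_square)
    \<comment> \<open>A double root would be \<open>t = 2\<close>, forcing the excluded value
      \<theta> = 4.\<close>
    show "\<theta> - t \<noteq> t"
    proof
      assume "\<theta> - t = t"
      hence \<theta>2: "\<theta> = 2 * t" by (simp add: algebra_simps)
      have "t * (2 - t) = 0" using t unfolding \<theta>2 by (simp add: algebra_simps power2_eq_square)
      hence "t = 2" using t0 by simp
      thus False using \<theta>2 \<theta> by simp
    qed
  qed
  \<comment> \<open>The root is recovered from the sum, as
    \<open>t = \<theta> - (1 + suminf (g t))\<close>.\<close>
  show inj: "inj_on g R"
    by (rule inj_onI) (metis R(2) diff_diff_eq2 add_diff_cancel_left')
  show "Per2_F l = g ` R"
  proof (intro equalityI subsetI)
    fix x assume "x \<in> Per2_F l"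
    hence x: "x \<in> F_dom" "F_op l x \<in> F_dom" "F_op l (F_op l x) = x" "F_op l x \<noteq> x"
      by (auto simp: Per2_F_def Fix_F_def)
    define s where "s = 1 + suminf x"
    define t where "t = 1 + suminf (g s)"
    have st: "s \<noteq> 0" "t \<noteq> 0" "x = g t" "g s \<noteq> x"
      using x by (auto simp: F dom s_def t_def)
    hence "s \<noteq> t" by auto
    moreover have "t = 1 + \<theta> * (1 / s)\<^sup>2" by (simp add: t_def gs)
    moreover have "s = 1 + \<theta> * (1 / t)\<^sup>2" by (simp add: s_def st(3) gs)
    ultimately have *: "s + t = \<theta>" "s * t = \<theta>" using two_cycle_sum_product[OF st(1,2)] by blast+
    \<comment> \<open>By Vieta, \<open>s\<close> and \<open>t\<close> are the roots of the quadratic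
      with this sum and product.\<close>
    have "t\<^sup>2 - (s + t) * t + s * t = 0" by (simp add: algebra_simps power2_eq_square)
    hence "t \<in> R" unfolding * R_def by simp
    thus "x \<in> g ` R" using st by blast
  next
    fix x assume "x \<in> g ` R"
    then obtain t where t: "t \<in> R" and x: "x = g t" by blast
    note Rt = R[OF t] and Rs = R[OF R(3)[OF t]]
    have "F_op l x = g (\<theta> - t)" unfolding F x Rt(2) ..
    moreover from this have "F_op l (F_op l x) = x" by (simp add: F Rs(2) x)
    moreover have "g (\<theta> - t) \<noteq> g t" using inj_onD[OF inj _ Rt(3) t] Rt(4) by blast
    ultimately show "x \<in> Per2_F l"
      using Rt Rs gc by (simp add: Per2_F_def Fix_F_def dom x)
  qed
qed

text \<open>Completing the square turns roots \<open>t\<close> into square roots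
  \<open>2 t - \<theta>\<close> of the discriminant. It is nonzero since \<theta> is neither 0 nor
  4, so there are two roots or none.\<close>

lemma card_Per2_F:
  fixes l :: "nat \<Rightarrow> 'p::prime_card padic"
  assumes l: "l \<in> c0" and \<theta>: "\<theta> = (\<Sum>n. l n)" "\<theta> \<noteq> 0" "\<theta> \<noteq> 4"
  shows "finite (Per2_F l)"
    and "card (Per2_F l) = (if \<exists>z. z\<^sup>2 = \<theta> * (\<theta> - 4) then 2 else 0)"
proof -
  let ?R = "{t. t\<^sup>2 - \<theta> * t + \<theta> = 0}"
  have R: "t \<in> ?R \<longleftrightarrow> (2 * t - \<theta>)\<^sup>2 = \<theta> * (\<theta> - 4)" for t
  proof -
    have "(2 * t - \<theta>)\<^sup>2 - \<theta> * (\<theta> - 4) = 4 * (t\<^sup>2 - \<theta> * t + \<theta>)"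
      by (simp add: algebra_simps power2_eq_square)
    moreover have "t \<in> ?R \<longleftrightarrow> 4 * (t\<^sup>2 - \<theta> * t + \<theta>) = 0"
      unfolding mult_eq_0_iff by simp
    ultimately show ?thesis using eq_iff_diff_eq_0[of "(2 * t - \<theta>)\<^sup>2" "\<theta> * (\<theta> - 4)"]
      by (simp only:)
  qed
  have "finite ?R \<and> card ?R = (if \<exists>z. z\<^sup>2 = \<theta> * (\<theta> - 4) then 2 else 0)"
  proof (cases "\<exists>z. z\<^sup>2 = \<theta> * (\<theta> - 4)")
    case True
    then obtain z where z: "z\<^sup>2 = \<theta> * (\<theta> - 4)" ..
    have z0: "z \<noteq> 0" using z \<theta> by auto
    have "t \<in> ?R \<longleftrightarrow> t = (\<theta> + z) / 2 \<or> t = (\<theta> - z) / 2" for t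
      unfolding R z[symmetric] power2_eq_iff by (auto simp: field_simps)
    hence "?R = {(\<theta> + z) / 2, (\<theta> - z) / 2}" by blast
    moreover have "(\<theta> + z) / 2 \<noteq> (\<theta> - z) / 2"
    proof
      assume "(\<theta> + z) / 2 = (\<theta> - z) / 2"
      hence eq: "\<theta> + z = \<theta> - z" by simp
      have "2 * z = (\<theta> + z) - (\<theta> - z)" by simp
      also have "\<dots> = 0" unfolding eq by simp
      finally show False using z0 by simp
    qed
    ultimately show ?thesis using True by simp
  next
    case False
    hence "?R = {}" using R by blast
    thus ?thesis using False by (simp only: card.empty finite.emptyI if_False simp_thms)
  qed
  thus "finite (Per2_F l)" "card (Per2_F l) = (if \<exists>z. z\<^sup>2 = \<theta> * (\<theta> - 4) then 2 else 0)"
    unfolding Per2_F_eq_image(1)[OF l \<theta>] card_image[OF Per2_F_eq_image(2)[OF l \<theta>]] by simp_all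
qed

text \<open>Finiteness is included because \<open>card\<close> is 0 on infinite sets. In the last
  two cases the divisibility says that \<theta> is congruent to 4, so \<open>\<theta> / 4\<close> is
  a square and \<open>\<theta> - 4\<close> alone decides; otherwise the residue of the factor
  \<theta> matters as well.\<close>

theorem theorem7:
  fixes p :: nat and l :: "nat \<Rightarrow> 'p::prime_card padic" and \<theta> :: "'p padic" and d :: "nat \<Rightarrow> nat"
  assumes "p = CARD('p)" and "p \<ge> 3"
    and "l \<in> c0" and "\<theta> = (\<Sum>n. l n)" and "\<theta> \<noteq> 0" and "\<theta> \<noteq> 4"
    and "\<And>j. d j \<in> {0..p - 1}" and "d 0 \<noteq> 0"
    and "\<theta> = of_nat p powi padic_ord \<theta> * (\<Sum>j. of_nat (d j) * of_nat p ^ j)"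
  shows "finite (Per2_F l) \<and>
    (padic_norm \<theta> > 1 \<longrightarrow> card (Per2_F l) = 2) \<and>
    (padic_norm \<theta> < 1 \<and> 2 dvd padic_ord \<theta> \<and> Legendre (- int (d 0)) (int p) = 1
      \<longrightarrow> card (Per2_F l) = 2) \<and>
    (padic_norm \<theta> < 1 \<and> (\<not> 2 dvd padic_ord \<theta> \<or> Legendre (- int (d 0)) (int p) = -1)
      \<longrightarrow> card (Per2_F l) = 0) \<and>
    (padic_norm \<theta> = 1 \<and> Legendre ((int (d 0))\<^sup>2 - 4 * int (d 0)) (int p) = 1
      \<longrightarrow> card (Per2_F l) = 2) \<and>
    (padic_norm \<theta> = 1 \<and> Legendre ((int (d 0))\<^sup>2 - 4 * int (d 0)) (int p) = -1
      \<longrightarrow> card (Per2_F l) = 0) \<and>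
    (padic_norm \<theta> = 1 \<and> int p dvd (int (d 0))\<^sup>2 - 4 * int (d 0) \<and>
        2 dvd padic_ord (\<theta> - 4) \<and>
        Legendre (padic_mod_p (padic_unit_part (\<theta> - 4))) (int p) = 1
      \<longrightarrow> card (Per2_F l) = 2) \<and>
    (padic_norm \<theta> = 1 \<and> int p dvd (int (d 0))\<^sup>2 - 4 * int (d 0) \<and>
        (\<not> 2 dvd padic_ord (\<theta> - 4) \<or>
         Legendre (padic_mod_p (padic_unit_part (\<theta> - 4))) (int p) = -1)
      \<longrightarrow> card (Per2_F l) = 0)"
proof -
  define k where "k = padic_ord \<theta>"
  define u where "u = (\<Sum>j. of_nat (d j) * of_nat p ^ j :: 'p padic)"
  define r where "r = int (d 0)"
  define v where "v = padic_unit_part (\<theta> - 4)"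
  define w where "w = padic_mod_p v"
  have \<theta>: "\<theta> \<noteq> 0" "\<theta> - 4 \<noteq> 0" using assms by auto
  have p: "prime p" using assms(1) prime_card by blast
  have odd: "CARD('p) \<noteq> 2" using assms(1,2) by simp
  have p4: "\<not> int p dvd 4"
  proof
    assume "int p dvd 4"
    hence "int p dvd int (2 ^ 2)" by simp
    hence "p dvd 2 ^ 2" unfolding of_nat_dvd_iff .
    hence "p dvd 2" using p prime_dvd_power by blast
    thus False using assms(2) dvd_imp_le[of p 2] by simp
  qed
  have n4: "padic_norm (4 :: 'p padic) = 1"
    using p4 padic_norm_of_int_eq_1_iff[of 4, where 'p = 'p] assms(1) by simp
  have r: "\<not> int p dvd r"
    using assms(7)[of 0] assms(2,8) zdvd_not_zless[of r "int p"] by (auto simp: r_def)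
  have \<theta>u: "\<theta> = of_nat p powi k * u" using assms(9) by (simp add: k_def u_def)
  have ur: "padic_norm (u - of_int r) < 1"
    using padic_digit_series_residue[of d, where 'p = 'p] assms(1) by (simp add: u_def r_def)
  have v: "\<theta> - 4 = of_nat p powi padic_ord (\<theta> - 4) * v" "padic_norm v = 1"
    using padic_unit_part[OF \<theta>(2)] assms(1) by (simp_all add: v_def)
  have w: "padic_norm (v - of_int w) < 1" unfolding w_def by (rule padic_mod_p) (simp add: v)
  \<comment> \<open>If \<open>p\<close> divided \<open>w\<close>, then
    \<open>v = (v - w) + w\<close> would have norm below 1.\<close>
  have pw: "\<not> int p dvd w"
    using padic_norm_of_int(2)[of w, where 'p = 'p] padic_norm_add_less[OF w, of "of_int w"] v(2) assms(1)
    by auto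
  have two: "\<theta> * (\<theta> - 4) = 2\<^sup>2 * (\<theta> * (\<theta> - 4) / 4)" by simp
  note sq4 = square_mult_iff[of 2 "\<theta> * (\<theta> - 4) / 4", folded two, OF zero_neq_numeral[symmetric]]
  \<comment> \<open>Division by \<open>\<theta>\<^sup>2\<close> leaves
    \<open>1 - 4 / \<theta>\<close>, a unit with residue 1.\<close>
  have gt: "\<exists>z. z\<^sup>2 = \<theta> * (\<theta> - 4)" if "padic_norm \<theta> > 1"
  proof -
    have "padic_norm ((1 - 4 / \<theta>) - of_int 1) < 1"
      using that by (simp add: padic_norm_divide n4)
    from padic_unit_square_iff[OF odd _ this] have "\<exists>z. z\<^sup>2 = 1 - 4 / \<theta>"
      using p assms(1,2) by (auto simp: QuadRes_def intro!: exI[of _ 1])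
    moreover have "\<theta>\<^sup>2 * (1 - 4 / \<theta>) = \<theta> * (\<theta> - 4)"
      using \<theta> by (simp add: field_simps power2_eq_square)
    ultimately show ?thesis using square_mult_iff[OF \<theta>(1), of "1 - 4 / \<theta>"] by simp
  qed
  \<comment> \<open>Division by 4 leaves \<open>p ^ k\<close> times the unit
    \<open>u * (\<theta> / 4 - 1)\<close>, whose residue is \<open>- r\<close>.\<close>
  have lt: "(\<exists>z. z\<^sup>2 = \<theta> * (\<theta> - 4)) \<longleftrightarrow> even k \<and> QuadRes (int p) (- r)" if "padic_norm \<theta> < 1"
  proof -
    have "padic_norm ((\<theta> / 4 - 1) - of_int (- 1)) < 1"
      using that by (simp add: padic_norm_divide n4)
    from padic_residue_mult[OF ur this] have "padic_norm (u * (\<theta> / 4 - 1) - of_int (- r)) < 1" by simp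
    from padic_square_iff[OF odd _ this, of k] r
    have "(\<exists>z. z\<^sup>2 = of_nat p powi k * (u * (\<theta> / 4 - 1))) \<longleftrightarrow> even k \<and> QuadRes (int p) (- r)"
      by (simp add: assms(1))
    moreover have "of_nat p powi k * (u * (\<theta> / 4 - 1)) = \<theta> * (\<theta> - 4) / 4"
      \<comment> \<open>Only the outer factor \<theta> on the right is expanded; the occurrences in
        \<open>\<theta> / 4 - 1\<close> and \<open>\<theta> - 4\<close> stay.\<close>
      by (subst (2) \<theta>u) (simp add: field_simps)
    ultimately show ?thesis using sq4 by (simp only:)
  qed
  have u\<theta>: "padic_norm (\<theta> - of_int r) < 1" if "padic_norm \<theta> = 1"
  proof -
    have "k = 0" unfolding k_def by (rule padic_ord_unique) (simp add: that)
    thus ?thesis using \<theta>u ur by simp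
  qed
  have eq: "(\<exists>z. z\<^sup>2 = \<theta> * (\<theta> - 4)) \<longleftrightarrow> QuadRes (int p) (r\<^sup>2 - 4 * r)"
    if "padic_norm \<theta> = 1" "\<not> int p dvd r\<^sup>2 - 4 * r"
  proof -
    have "padic_norm (\<theta> - 4 - of_int (r - 4)) < 1" using u\<theta>[OF that(1)] by simp
    from padic_residue_mult[OF u\<theta>[OF that(1)] this]
    have "padic_norm (\<theta> * (\<theta> - 4) - of_int (r\<^sup>2 - 4 * r)) < 1"
      by (simp add: algebra_simps power2_eq_square)
    from padic_unit_square_iff[OF odd _ this] that(2) show ?thesis by (simp add: assms(1))
  qed
  \<comment> \<open>As \<open>p\<close> divides \<open>r (r - 4)\<close> but not \<open>r\<close>,
    the residue of \<theta> is that of 4. So \<open>\<theta> / 4\<close> has residue 1, and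
    multiplying \<open>v\<close> by it preserves the residue \<open>w\<close>.\<close>
  have eq4: "(\<exists>z. z\<^sup>2 = \<theta> * (\<theta> - 4)) \<longleftrightarrow> even (padic_ord (\<theta> - 4)) \<and> QuadRes (int p) w"
    if "padic_norm \<theta> = 1" "int p dvd r\<^sup>2 - 4 * r"
  proof -
    have "int p dvd r * (r - 4)" using that(2) by (simp add: algebra_simps power2_eq_square)
    hence "int p dvd r - 4" using r p by (simp add: prime_dvd_mult_iff)
    hence "padic_norm (of_int (r - 4) :: 'p padic) < 1" unfolding padic_norm_of_int assms(1) .
    from padic_norm_add_less[OF u\<theta>[OF that(1)] this] have "padic_norm (\<theta> - 4) < 1" by simp
    moreover have "\<theta> / 4 - of_int 1 = (\<theta> - 4) / 4" by (simp add: field_simps)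
    ultimately have "padic_norm (\<theta> / 4 - of_int 1) < 1" by (simp only: padic_norm_divide n4)
    from padic_residue_mult[OF this w] have "padic_norm (\<theta> / 4 * v - of_int w) < 1" by simp
    from padic_square_iff[OF odd _ this, of "padic_ord (\<theta> - 4)"] pw
    have "(\<exists>z. z\<^sup>2 = of_nat p powi padic_ord (\<theta> - 4) * (\<theta> / 4 * v)) \<longleftrightarrow>
        even (padic_ord (\<theta> - 4)) \<and> QuadRes (int p) w"
      by (simp add: assms(1))
    moreover have "of_nat p powi padic_ord (\<theta> - 4) * (\<theta> / 4 * v) = \<theta> * (\<theta> - 4) / 4"
      using v(1) by (metis mult.left_commute mult.commute times_divide_eq_left)
    ultimately show ?thesis using sq4 by (simp only:)
  qed
  \<comment> \<open>\<open>Legendre\<close> is 0 on multiples of \<open>p\<close>, so both values 1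
    and -1 entail that \<open>p\<close> does not divide \<open>a\<close>.\<close>
  have leg: "Legendre a (int p) = 1 \<longleftrightarrow> \<not> int p dvd a \<and> QuadRes (int p) a"
    "Legendre a (int p) = -1 \<longleftrightarrow> \<not> int p dvd a \<and> \<not> QuadRes (int p) a" for a
    by (simp_all add: Legendre_def cong_0_iff)
  show ?thesis
    unfolding card_Per2_F(2)[OF assms(3-6)] leg
      r_def[symmetric] k_def[symmetric] v_def[symmetric] w_def[symmetric]
    using card_Per2_F(1)[OF assms(3-6)] gt lt eq eq4 by auto
qed

end
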